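(* For all $p$ and $q$ such that $4\le p<q\le\infty$, with $a:=1/p$, $$\tfrac12\,d_{\mathrm{TV}}(p,q)=d_{\mathrm{Ko}}(p,q)<B(a,\tilde x_a)<\frac Cp.$$
   Context: For real $p>0$ (not necessarily an integer), the density and distribution functions of Student's distribution with $p$ degrees of freedom are $$f_p(x)=\frac{\Gamma\left(\frac{p+1}{2}\right)}{\sqrt{\pi p}\,\Gamma\left(\frac p2\right)}\left(1+\frac{x^2}{p}\right)^{-(p+1)/2},\qquad F_p(x)=\int_{-\infty}^x f_p(u)\,du,\qquad x\in\mathbb{R}.$$ For $p=\infty$, $f_\infty=\varphi$ and $F_\infty=\Phi$ are the density and distribution functions of the standard normal distribution. For $p,q\in(0,\infty]$, $$d_{\mathrm{Ko}}(p,q)=\sup_{x\in\mathbb{R}}|F_p(x)-F_q(x)|,\qquad d_{\mathrm{TV}}(p,q)=\frac12\int_{-\infty}^\infty|f_p(x)-f_q(x)|\,dx.$$ Further, $$C:=\frac14\sqrt{\frac{7+5\sqrt2}{\pi e^{1+\sqrt2}}},$$ $$B(a,x):=\frac a{768}\Big(8x\big[5a^2x^2+a(3x^6-7x^4-5x^2-3)+24(x^2+1)\big]\varphi(x)+33a^2(2\Phi(x)-1)\Big),$$ and $\tilde x_a$ is, for any $a\in(0,1)$, the unique real root $x>0$ of the polynomial equation $$P(a,x):=-96(x^4-2x^2-1)-4a(3x^8-28x^6+30x^4+12x^2+3)-a^2(20x^4-60x^2-33)=0.$$ *)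

theory Defs
  imports "HOL-Probability.Probability"
begin

text \<open>Degrees of freedom range over \<open>(0, \<infinity>]\<close>, represented by the positive elements of
  \<^typ>\<open>ereal\<close>; the value at \<open>\<infinity>\<close> is the standard normal distribution. Arguments \<open>p \<le> 0\<close> are
  outside the intended domain.\<close>

definition student_density :: "ereal \<Rightarrow> real \<Rightarrow> real" where
  "student_density p x =
     (if p = \<infinity> then std_normal_density x
      else let r = real_of_ereal p in
        Gamma ((r + 1) / 2) / (sqrt (pi * r) * Gamma (r / 2))
          * (1 + x\<^sup>2 / r) powr (- (r + 1) / 2))"

definition student_cdf :: "ereal \<Rightarrow> real \<Rightarrow> real" where
  "student_cdf p x = (LINT u:{..x}|lborel. student_density p u)"

definition std_normal_cdf :: "real \<Rightarrow> real" where
  "std_normal_cdf = cdf std_normal_distribution"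

lemma student_cdf_infinity: "student_cdf \<infinity> = std_normal_cdf"
proof
  fix x :: real
  interpret prob_space std_normal_distribution
    by (rule prob_space_normal_density) simp
  have "std_normal_cdf x = integral\<^sup>L std_normal_distribution (indicator {..x})"
    by (simp add: std_normal_cdf_def cdf_def)
  also have "\<dots> = (LINT u|lborel. std_normal_density u * indicator {..x} u)"
    by (subst integral_density) (auto)
  also have "\<dots> = student_cdf \<infinity> x"
    by (simp add: student_cdf_def student_density_def set_lebesgue_integral_def mult.commute)
  finally show "student_cdf \<infinity> x = std_normal_cdf x" ..
qed

definition d_Ko :: "ereal \<Rightarrow> ereal \<Rightarrow> real" where
  "d_Ko p q = (SUP x::real. \<bar>student_cdf p x - student_cdf q x\<bar>)"

definition d_TV :: "ereal \<Rightarrow> ereal \<Rightarrow> real" where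
  "d_TV p q = 1 / 2 * (LINT x|lborel. \<bar>student_density p x - student_density q x\<bar>)"

definition C_const :: real where
  "C_const = 1 / 4 * sqrt ((7 + 5 * sqrt 2) / (pi * exp (1 + sqrt 2)))"

definition B_fun :: "real \<Rightarrow> real \<Rightarrow> real" where
  "B_fun a x = a / 768 *
     (8 * x * (5 * a\<^sup>2 * x\<^sup>2 + a * (3 * x ^ 6 - 7 * x ^ 4 - 5 * x\<^sup>2 - 3) + 24 * (x\<^sup>2 + 1))
        * std_normal_density x
      + 33 * a\<^sup>2 * (2 * std_normal_cdf x - 1))"

definition P_poly :: "real \<Rightarrow> real \<Rightarrow> real" where
  "P_poly a x =
     - 96 * (x ^ 4 - 2 * x\<^sup>2 - 1)
     - 4 * a * (3 * x ^ 8 - 28 * x ^ 6 + 30 * x ^ 4 + 12 * x\<^sup>2 + 3)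
     - a\<^sup>2 * (20 * x ^ 4 - 60 * x\<^sup>2 - 33)"

text \<open>Intended for \<open>0 < a < 1\<close>, where there is exactly one positive root.\<close>

definition x_tilde :: "real \<Rightarrow> real" where
  "x_tilde a = (THE x. 0 < x \<and> P_poly a x = 0)"

end

theory Submission
  imports Defs
begin

text \<open>
  Write \<open>t = x\<^sup>2\<close> and \<open>a = 1 / p\<close>.  The logarithm of \<open>f\<^sub>p / f\<^sub>q\<close> is a function of \<open>t\<close> whose
  derivative has the sign of \<open>t - 1\<close>.  It is negative at the origin, because the height
  \<open>f\<^sub>p 0\<close> increases with \<open>p\<close>, and it cannot stay negative, because both densities have mass one.
  Hence \<open>f\<^sub>p - f\<^sub>q\<close> changes sign exactly once on the positive axis, at some \<open>c\<close>
  (\<open>student_densities_cross_once\<close>).  For two symmetric densities that cross only at \<open>c\<close> and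
  \<open>- c\<close>, the difference of the distribution functions is extremal at \<open>c\<close>, and integrating
  \<open>\<bar>f\<^sub>p - f\<^sub>q\<bar>\<close> over the three intervals cut out by \<open>c\<close> and \<open>- c\<close> gives four times that extremum.
  This is the equality, and it also yields \<open>F\<^sub>p \<le> F\<^sub>q \<le> \<Phi>\<close> on the positive axis, so that the
  Kolmogorov distance is at most \<open>\<Phi> c - F\<^sub>p c\<close>.

  For the first inequality, \<open>B a\<close> vanishes at \<open>0\<close> and has derivative \<open>a \<phi> P / 384\<close>; here \<open>- a P / 384\<close>
  agrees up to order \<open>a\<^sup>2\<close> with the expansion of \<open>f\<^sub>p / \<phi> - 1\<close>, and its third-order part is chosen
  so that \<open>f\<^sub>p / \<phi> > 1 - a P / 384\<close> for \<open>t \<le> 31 / 10\<close> (\<open>student_density_gt\<close>).  Integrating gives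
  \<open>\<Phi> - F\<^sub>p < B a\<close> up to \<open>x = sqrt (31 / 10)\<close>.  Beyond that point \<open>P\<close> is negative, \<open>f\<^sub>p\<close> exceeds
  \<open>\<phi>\<close> and \<open>\<Phi> - F\<^sub>p\<close> decreases.  As \<open>P\<close> changes sign only at the root defining \<open>x_tilde a\<close>, from plus
  to minus, that root maximises \<open>B a\<close>.

  For the second inequality, \<open>B a x / a\<close> is a quadratic in \<open>a\<close> with nonnegative leading coefficient, hence
  convex, and only \<open>a = 0\<close> and \<open>a = 1 / 4\<close> matter.  At \<open>a = 0\<close> the maximum over \<open>x\<close> is
  exactly \<open>C\<close>, attained at \<open>t = 1 + sqrt 2\<close>; at \<open>a = 1 / 4\<close> it stays below \<open>C\<close> by less than
  \<open>0.00004\<close>, which is decided by an enclosure of the root (\<open>B_fun_quarter_less\<close>).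
\<close>

section \<open>The normalising constant\<close>

text \<open>With \<open>z = p / 2\<close> this is the logarithm of \<open>f\<^sub>p 0 / \<phi> 0\<close>, so it carries the whole dependence of the
  normalising constant on \<open>p\<close>.\<close>

definition ln_gamma_half_step :: "real \<Rightarrow> real" where
  "ln_gamma_half_step z = ln (Gamma (z + 1 / 2)) - ln (Gamma z) - ln z / 2"

lemma ln_Gamma_plus1:
  fixes z :: real
  assumes "z > 0"
  shows "ln (Gamma (z + 1)) = ln z + ln (Gamma z)"
proof -
  have "z \<notin> \<int>\<^sub>\<le>\<^sub>0"
    using assms by (auto elim!: nonpos_Ints_cases')
  then show ?thesis
    using assms by (simp add: Gamma_plus1 ln_mult Gamma_real_pos less_imp_neq[OF Gamma_real_pos, symmetric])
qed

text \<open>Unit increments are elementary and the function vanishes at infinity.  Monotonicity and bounds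
  therefore follow by telescoping, without any expansion of the Gamma function.\<close>

lemma ln_gamma_half_step_plus1:
  assumes "z > 0"
  shows "ln_gamma_half_step (z + 1) - ln_gamma_half_step z = ln (1 + 1 / (4 * z * (z + 1))) / 2"
proof -
  have "ln (Gamma (z + 1 + 1 / 2)) = ln (z + 1 / 2) + ln (Gamma (z + 1 / 2))"
    using ln_Gamma_plus1[of "z + 1 / 2"] assms by (simp add: add_ac)
  moreover
  have "1 + 1 / (4 * z * (z + 1)) = (z + 1 / 2)\<^sup>2 / (z * (z + 1))"
    using assms by (simp add: divide_simps power2_eq_square) (simp add: algebra_simps)
  then have "ln (1 + 1 / (4 * z * (z + 1))) = 2 * ln (z + 1 / 2) - (ln z + ln (z + 1))"
    using assms by (simp add: ln_div ln_mult ln_realpow)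
  ultimately show ?thesis
    using assms by (simp add: ln_gamma_half_step_def ln_Gamma_plus1)
qed

lemma ln_Gamma_midpoint_le:
  fixes z :: real
  assumes "z > 0"
  shows "2 * ln (Gamma (z + 1 / 2)) \<le> ln (Gamma z) + ln (Gamma (z + 1))"
proof -
  have "(ln \<circ> Gamma) ((1 - 1 / 2) *\<^sub>R z + (1 / 2) *\<^sub>R (z + 1))
          \<le> (1 - 1 / 2) * (ln \<circ> Gamma) z + (1 / 2) * (ln \<circ> Gamma) (z + 1)"
    using assms by (intro convex_onD[OF log_convex_Gamma_real]) auto
  moreover have "(1 - 1 / 2) *\<^sub>R z + (1 / 2) *\<^sub>R (z + 1) = z + 1 / 2"
    by (simp add: field_simps)
  ultimately show ?thesis
    by simp
qed

lemma ln_gamma_half_step_nonpos: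
  assumes "z > 0"
  shows "ln_gamma_half_step z \<le> 0"
  using ln_Gamma_midpoint_le[OF assms] ln_Gamma_plus1[OF assms]
  by (simp add: ln_gamma_half_step_def)

lemma ln_gamma_half_step_ge_ln:
  assumes "z > 0"
  shows "ln (z / (z + 1 / 2)) / 2 \<le> ln_gamma_half_step z"
proof -
  have "2 * ln (Gamma (z + 1)) \<le> ln (Gamma (z + 1 / 2)) + ln (Gamma (z + 1 / 2 + 1))"
    using ln_Gamma_midpoint_le[of "z + 1 / 2"] assms by (simp add: add_ac)
  then have "2 * (ln z + ln (Gamma z)) \<le> 2 * ln (Gamma (z + 1 / 2)) + ln (z + 1 / 2)"
    using ln_Gamma_plus1[of "z + 1 / 2"] assms by (simp add: ln_Gamma_plus1)
  then show ?thesis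
    using assms by (simp add: ln_gamma_half_step_def ln_div)
qed

text \<open>Log-convexity of Gamma at the midpoints \<open>z + 1 / 2\<close> and \<open>z + 1\<close> gives the two sides of the
  squeeze.\<close>

lemma ln_gamma_half_step_tendsto_0:
  assumes "z > 0"
  shows "(\<lambda>n. ln_gamma_half_step (z + real n)) \<longlonglongrightarrow> 0"
proof (rule tendsto_sandwich)
  show "(\<lambda>n. ln ((z + real n) / (z + real n + 1 / 2)) / 2) \<longlonglongrightarrow> 0"
    by real_asymp
  show "\<forall>\<^sub>F n in sequentially. ln ((z + real n) / (z + real n + 1 / 2)) / 2
          \<le> ln_gamma_half_step (z + real n)"
    using assms by (intro always_eventually allI ln_gamma_half_step_ge_ln) simp
  show "\<forall>\<^sub>F n in sequentially. ln_gamma_half_step (z + real n) \<le> 0"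
    using assms by (intro always_eventually allI ln_gamma_half_step_nonpos) simp
qed auto

text \<open>Unit increments decrease in \<open>z\<close>, so the difference between the values at \<open>w + n\<close> and \<open>z + n\<close>
  shrinks as \<open>n\<close> grows.  Its limit is \<open>0\<close>, so it is positive at \<open>n = 0\<close>.\<close>

lemma ln_gamma_half_step_strict_mono:
  assumes "0 < z" and "z < w"
  shows "ln_gamma_half_step z < ln_gamma_half_step w"
proof -
  define d where "d n = ln_gamma_half_step (w + real n) - ln_gamma_half_step (z + real n)" for n
  have step: "d (Suc n) < d n" for n
  proof -
    have pos: "0 < z + n" "0 < w + n"
      using assms by auto
    have "(z + n) * (z + n + 1) < (w + n) * (w + n + 1)"
      using assms by (auto intro!: mult_strict_mono)
    then have "1 / (4 * (w + n) * (w + n + 1)) < 1 / (4 * (z + n) * (z + n + 1))"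
      using pos unfolding mult.assoc
      by (intro divide_strict_left_mono mult_strict_left_mono mult_pos_pos) auto
    moreover have "0 < 1 / (4 * (w + n) * (w + n + 1))"
      using assms by (intro divide_pos_pos mult_pos_pos) auto
    ultimately have "ln (1 + 1 / (4 * (w + n) * (w + n + 1))) < ln (1 + 1 / (4 * (z + n) * (z + n + 1)))"
      by (intro ln_less_cancel_iff[THEN iffD2]) linarith+
    then show ?thesis
      using ln_gamma_half_step_plus1[of "z + n"] ln_gamma_half_step_plus1[of "w + n"] assms
      by (simp add: d_def add_ac)
  qed
  have "d \<longlonglongrightarrow> 0 - 0"
    unfolding d_def using assms by (intro tendsto_diff ln_gamma_half_step_tendsto_0) auto
  moreover have "decseq d"
    using step by (intro decseq_SucI less_imp_le)
  ultimately have "0 \<le> d (Suc 0)"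
    using decseq_ge[of d 0 "Suc 0"] by simp
  also have "\<dots> < d 0"
    by (rule step)
  finally show ?thesis
    by (simp add: d_def)
qed

lemma ln_gamma_half_step_neg:
  assumes "z > 0"
  shows "ln_gamma_half_step z < 0"
  using ln_gamma_half_step_strict_mono[of z "z + 1"] ln_gamma_half_step_nonpos[of "z + 1"] assms
  by simp

text \<open>By \<open>ln (1 + u) \<le> u\<close> each unit increment is at most the telescoping difference
  \<open>1 / (8 * z) - 1 / (8 * (z + 1))\<close>.\<close>

lemma ln_gamma_half_step_lower:
  assumes "z > 0"
  shows "- 1 / (8 * z) \<le> ln_gamma_half_step z"
proof -
  define e where "e n = ln_gamma_half_step (z + real n) + 1 / (8 * (z + real n))" for n
  have "e (Suc n) \<le> e n" for n
  proof -
    have "ln (1 + 1 / (4 * (z + n) * (z + n + 1))) \<le> 1 / (4 * (z + n) * (z + n + 1))"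
      using assms by (intro ln_add_one_self_le_self) auto
    moreover have "1 / (4 * (z + n) * (z + n + 1)) = 2 * (1 / (8 * (z + n)) - 1 / (8 * (z + n + 1)))"
      using assms by (simp add: divide_simps) (simp add: algebra_simps)
    ultimately show ?thesis
      using ln_gamma_half_step_plus1[of "z + n"] assms by (simp add: e_def add_ac)
  qed
  then have "decseq e"
    by (rule decseq_SucI)
  moreover have "e \<longlonglongrightarrow> 0 + 0"
    unfolding e_def using assms
    by (intro tendsto_add ln_gamma_half_step_tendsto_0) (auto, real_asymp)
  ultimately have "0 \<le> e 0"
    using decseq_ge[of e 0 0] by simp
  then show ?thesis
    by (simp add: e_def)
qed

section \<open>Student densities\<close>

text \<open>The logarithm of the density in the variable \<open>t = x\<^sup>2\<close>.  The standard normal part is split off, so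
  that the conditional is the logarithm of the ratio to the normal density.\<close>

definition student_log_density :: "ereal \<Rightarrow> real \<Rightarrow> real" where
  "student_log_density p t =
     (if p = \<infinity> then 0 else let r = real_of_ereal p in
        ln_gamma_half_step (r / 2) + (t / 2 - (r + 1) / 2 * ln (1 + t / r)))
     - t / 2 - ln (2 * pi) / 2"

lemma student_density_eq_exp:
  assumes "0 < p"
  shows "student_density p x = exp (student_log_density p (x\<^sup>2))"
proof (cases p)
  case (real r)
  then have r: "0 < r"
    using assms by simp
  then have "0 < 1 + x\<^sup>2 / r"
    by (simp add: add_pos_nonneg)
  then have "student_density p x
      = exp (ln (Gamma (r / 2 + 1 / 2))) / (exp (ln (pi * r) / 2) * exp (ln (Gamma (r / 2))))
        * exp (- (r + 1) / 2 * ln (1 + x\<^sup>2 / r))"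
    using r by (simp add: real student_density_def powr_def add_divide_distrib ln_sqrt[symmetric])
  also have "\<dots> = exp (ln (Gamma (r / 2 + 1 / 2)) - (ln (pi * r) / 2 + ln (Gamma (r / 2)))
        + - (r + 1) / 2 * ln (1 + x\<^sup>2 / r))"
    by (simp only: exp_add exp_diff)
  also have "\<dots> = exp (student_log_density p (x\<^sup>2))"
    using r by (simp add: real student_log_density_def ln_gamma_half_step_def ln_mult ln_div diff_divide_distrib add_divide_distrib ring_distribs)
  finally show ?thesis .
next
  case PInf
  have "sqrt (2 * pi) = exp (ln (2 * pi) / 2)"
    by (simp add: ln_sqrt[symmetric])
  then have "std_normal_density x = exp (- x\<^sup>2 / 2) / exp (ln (2 * pi) / 2)"
    by (simp add: std_normal_density_def)
  also have "\<dots> = exp (- x\<^sup>2 / 2 - ln (2 * pi) / 2)"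
    by (rule exp_diff[symmetric])
  finally show ?thesis
    by (simp add: PInf student_density_def student_log_density_def)
qed (use assms in simp)

text \<open>This exhibits the kernel \<open>(1 + x\<^sup>2 / r) powr (- s)\<close> as a mixture of Gaussian kernels in \<open>x\<close>: take
  \<open>c = 1 + x\<^sup>2 / r\<close>.\<close>

lemma Gamma_times_powr_eq_nn_integral:
  fixes s c :: real
  assumes "0 < s" and "0 < c"
  shows "ennreal (Gamma s * c powr (- s))
           = (\<integral>\<^sup>+u. ennreal (indicator {0..} u * u powr (s - 1) * exp (- u * c)) \<partial>lborel)"
proof -
  have "ennreal (Gamma s) = (\<integral>\<^sup>+t. ennreal (indicator {0..} t * t powr (s - 1) / exp t) \<partial>lborel)"
    by (rule Gamma_conv_nn_integral_real) fact
  also have "\<dots> = c * (\<integral>\<^sup>+u. ennreal (indicator {0..} (0 + c * u) * (0 + c * u) powr (s - 1)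
                        / exp (0 + c * u)) \<partial>lborel)"
    using assms by (subst nn_integral_real_affine[where c = c and t = 0]) auto
  also have "\<dots> = c * (\<integral>\<^sup>+u. ennreal (c powr (s - 1)) *
                        ennreal (indicator {0..} u * u powr (s - 1) * exp (- u * c)) \<partial>lborel)"
    using assms
    by (intro arg_cong2[where f = times] nn_integral_cong refl)
       (auto simp: indicator_def zero_le_mult_iff powr_mult exp_minus field_simps ennreal_mult'[symmetric])
  also have "\<dots> = ennreal (c powr s) *
                     (\<integral>\<^sup>+u. ennreal (indicator {0..} u * u powr (s - 1) * exp (- u * c)) \<partial>lborel)"
    using assms
    by (subst nn_integral_cmult) (auto simp: mult.assoc[symmetric] ennreal_mult'[symmetric] powr_mult_base)
  finally have eq: "ennreal (Gamma s) = ennreal (c powr s) *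
                     (\<integral>\<^sup>+u. ennreal (indicator {0..} u * u powr (s - 1) * exp (- u * c)) \<partial>lborel)" .
  have "ennreal (Gamma s * c powr (- s)) = ennreal (c powr (- s)) * ennreal (Gamma s)"
    using assms by (simp add: ennreal_mult'[symmetric] mult.commute)
  also have "\<dots> = (ennreal (c powr (- s)) * ennreal (c powr s)) *
                     (\<integral>\<^sup>+u. ennreal (indicator {0..} u * u powr (s - 1) * exp (- u * c)) \<partial>lborel)"
    by (simp only: eq mult.assoc)
  also have "ennreal (c powr (- s)) * ennreal (c powr s) = 1"
    using assms by (subst ennreal_mult'[symmetric]) (auto simp: powr_add[symmetric])
  finally show ?thesis
    by simp
qed

lemma nn_integral_gaussian:
  assumes "0 < b"
  shows "(\<integral>\<^sup>+x. ennreal (exp (- b * x\<^sup>2)) \<partial>lborel) = ennreal (sqrt (pi / b))"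
proof -
  define \<sigma> where "\<sigma> = sqrt (1 / (2 * b))"
  have \<sigma>: "0 < \<sigma>" "\<sigma>\<^sup>2 = 1 / (2 * b)"
    using assms by (auto simp: \<sigma>_def)
  have "2 * pi * \<sigma>\<^sup>2 = pi / b" and "x\<^sup>2 / (2 * \<sigma>\<^sup>2) = b * x\<^sup>2" for x :: real
    using assms by (simp_all add: \<sigma>)
  then have density: "sqrt (pi / b) * normal_density 0 \<sigma> x = exp (- b * x\<^sup>2)" for x
    using assms by (simp add: normal_density_def)
  have "(\<integral>\<^sup>+x. ennreal (exp (- b * x\<^sup>2)) \<partial>lborel)
          = (\<integral>\<^sup>+x. ennreal (sqrt (pi / b)) * ennreal (normal_density 0 \<sigma> x) \<partial>lborel)"
    using assms by (simp add: ennreal_mult'[symmetric] density)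
  also have "\<dots> = ennreal (sqrt (pi / b)) * (\<integral>\<^sup>+x. ennreal (normal_density 0 \<sigma> x) \<partial>lborel)"
    by (rule nn_integral_cmult) auto
  also have "(\<integral>\<^sup>+x. ennreal (normal_density 0 \<sigma> x) \<partial>lborel) = 1"
    using \<sigma> by (subst nn_integral_eq_integral) (auto simp: integral_normal_density)
  finally show ?thesis
    by simp
qed

text \<open>After exchanging the integrals of the Gaussian mixture, the integral over \<open>x\<close> is Gaussian and
  contributes a factor \<open>sqrt (pi * r / u)\<close>; what remains is the Gamma integral at \<open>r / 2\<close>.\<close>

lemma nn_integral_student_kernel:
  fixes r :: real
  assumes "0 < r"
  shows "(\<integral>\<^sup>+x. ennreal (Gamma ((r + 1) / 2) * (1 + x\<^sup>2 / r) powr (- (r + 1) / 2)) \<partial>lborel)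
           = ennreal (sqrt (pi * r) * Gamma (r / 2))"
proof -
  define k where "k u x = ennreal (indicator {0..} u * u powr ((r - 1) / 2) * exp (- u))
                           * ennreal (exp (- (u / r) * x\<^sup>2))" for u x :: real
  have [measurable]: "case_prod k \<in> borel_measurable (lborel \<Otimes>\<^sub>M lborel)"
    unfolding k_def by measurable
  have "(\<integral>\<^sup>+x. ennreal (Gamma ((r + 1) / 2) * (1 + x\<^sup>2 / r) powr (- (r + 1) / 2)) \<partial>lborel)
          = (\<integral>\<^sup>+x. (\<integral>\<^sup>+u. k u x \<partial>lborel) \<partial>lborel)"
  proof (intro nn_integral_cong)
    fix x :: real
    have split: "ennreal (indicator {0..} u * u powr ((r + 1) / 2 - 1) * exp (- u * (1 + x\<^sup>2 / r))) = k u x" for u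
    proof -
      have "(r + 1) / 2 - 1 = (r - 1) / 2"
        by (simp add: field_simps)
      moreover have "exp (- u * (1 + x\<^sup>2 / r)) = exp (- u) * exp (- (u / r) * x\<^sup>2)"
        by (simp add: exp_add[symmetric] algebra_simps)
      ultimately show ?thesis
        by (simp only: k_def ennreal_mult''[symmetric] exp_ge_zero mult.assoc)
    qed
    have "0 < 1 + x\<^sup>2 / r"
      using assms by (simp add: add_pos_nonneg)
    then show "ennreal (Gamma ((r + 1) / 2) * (1 + x\<^sup>2 / r) powr (- (r + 1) / 2)) = (\<integral>\<^sup>+u. k u x \<partial>lborel)"
      using Gamma_times_powr_eq_nn_integral[of "(r + 1) / 2" "1 + x\<^sup>2 / r", unfolded split] assms
      by (simp only: minus_divide_left half_gt_zero add_pos_pos zero_less_one simp_thms)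
  qed
  also have "\<dots> = (\<integral>\<^sup>+u. (\<integral>\<^sup>+x. k u x \<partial>lborel) \<partial>lborel)"
    by (rule lborel_pair.Fubini') simp
  also have "\<dots> = (\<integral>\<^sup>+u. ennreal (sqrt (pi * r)) *
                     ennreal (indicator {0..} u * u powr (r / 2 - 1) / exp u) \<partial>lborel)"
  proof (intro nn_integral_cong)
    fix u :: real
    show "(\<integral>\<^sup>+x. k u x \<partial>lborel)
            = ennreal (sqrt (pi * r)) * ennreal (indicator {0..} u * u powr (r / 2 - 1) / exp u)"
    proof (cases "0 < u")
      case True
      have "(\<integral>\<^sup>+x. k u x \<partial>lborel) = ennreal (u powr ((r - 1) / 2) * exp (- u)) * ennreal (sqrt (pi / (u / r)))"
        unfolding k_def nn_integral_gaussian[OF divide_pos_pos[OF True assms], symmetric]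
        using True by (subst nn_integral_cmult) auto
      also have "sqrt (pi / (u / r)) = sqrt (pi * r) * u powr (- 1 / 2)"
        using True assms by (simp add: powr_minus powr_half_sqrt real_sqrt_divide real_sqrt_mult field_simps)
      also have "ennreal (u powr ((r - 1) / 2) * exp (- u)) * ennreal (sqrt (pi * r) * u powr (- 1 / 2))
          = ennreal (sqrt (pi * r)) * ennreal (u powr ((r - 1) / 2 + - 1 / 2) / exp u)"
      proof -
        have "u powr ((r - 1) / 2) * exp (- u) * (sqrt (pi * r) * u powr (- 1 / 2))
            = sqrt (pi * r) * (u powr ((r - 1) / 2 + - 1 / 2) / exp u)"
          unfolding powr_add exp_minus by (simp only: divide_inverse mult_ac)
        then show ?thesis
          using assms by (simp only: ennreal_mult'[symmetric] ennreal_mult''[symmetric] exp_ge_zero powr_ge_zero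
              mult_nonneg_nonneg real_sqrt_ge_zero pi_ge_zero less_imp_le)
      qed
      also have "(r - 1) / 2 + - 1 / 2 = r / 2 - 1"
        by (simp add: field_simps)
      finally show ?thesis
        using True by simp
    next
      case False
      then show ?thesis
        by (cases "u = 0") (auto simp: k_def indicator_def)
    qed
  qed
  also have "\<dots> = ennreal (sqrt (pi * r)) * ennreal (Gamma (r / 2))"
    using assms by (subst nn_integral_cmult) (auto simp: Gamma_conv_nn_integral_real)
  finally show ?thesis
    using assms by (simp add: ennreal_mult'[symmetric])
qed

lemma student_density_continuous:
  assumes "0 < p"
  shows "continuous_on UNIV (student_density p)"
proof -
  have "continuous_on UNIV (\<lambda>x. exp (student_log_density p (x\<^sup>2)))"
  proof (cases p)
    case (real r)
    then have "0 < r"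
      using assms by simp
    moreover from this have "1 + x\<^sup>2 / r \<noteq> 0" for x
      by (metis add_pos_nonneg divide_nonneg_pos less_irrefl zero_le_power2 zero_less_one)
    ultimately show ?thesis
      unfolding student_log_density_def Let_def by (cases "p = \<infinity>") (auto intro!: continuous_intros simp: real)
  qed (use assms in \<open>auto simp: student_log_density_def intro!: continuous_intros\<close>)
  also have "(\<lambda>x. exp (student_log_density p (x\<^sup>2))) = student_density p"
    using student_density_eq_exp[OF assms] by (intro ext) (rule sym)
  finally show ?thesis .
qed

lemma student_density_has_integral:
  assumes "0 < p"
  shows "has_bochner_integral lborel (student_density p) 1"
proof (rule has_bochner_integral_nn_integral)
  show "student_density p \<in> borel_measurable lborel"
    using borel_measurable_continuous_onI[OF student_density_continuous[OF assms]] by simp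
  show "AE x in lborel. 0 \<le> student_density p x"
    by (simp add: student_density_eq_exp[OF assms])
  show "(\<integral>\<^sup>+x. ennreal (student_density p x) \<partial>lborel) = ennreal 1"
  proof (cases p)
    case (real r)
    then have r: "0 < r"
      using assms by simp
    have "(\<integral>\<^sup>+x. ennreal (student_density p x) \<partial>lborel)
            = (\<integral>\<^sup>+x. ennreal (1 / (sqrt (pi * r) * Gamma (r / 2))) *
                   ennreal (Gamma ((r + 1) / 2) * (1 + x\<^sup>2 / r) powr (- (r + 1) / 2)) \<partial>lborel)"
      using r by (intro nn_integral_cong) (auto simp: real student_density_def Let_def ennreal_mult'[symmetric])
    also have "\<dots> = ennreal (1 / (sqrt (pi * r) * Gamma (r / 2))) *
        (\<integral>\<^sup>+x. ennreal (Gamma ((r + 1) / 2) * (1 + x\<^sup>2 / r) powr (- (r + 1) / 2)) \<partial>lborel)"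
      by (rule nn_integral_cmult) measurable
    also have "(\<integral>\<^sup>+x. ennreal (Gamma ((r + 1) / 2) * (1 + x\<^sup>2 / r) powr (- (r + 1) / 2)) \<partial>lborel)
        = ennreal (sqrt (pi * r) * Gamma (r / 2))"
      by (rule nn_integral_student_kernel[OF r])
    also have "ennreal (1 / (sqrt (pi * r) * Gamma (r / 2))) * \<dots>
        = ennreal (1 / (sqrt (pi * r) * Gamma (r / 2)) * (sqrt (pi * r) * Gamma (r / 2)))"
      using r by (intro ennreal_mult[symmetric]) auto
    also have "1 / (sqrt (pi * r) * Gamma (r / 2)) * (sqrt (pi * r) * Gamma (r / 2)) = 1"
    proof -
      have "0 < sqrt (pi * r) * Gamma (r / 2)"
        using r by simp
      then have "sqrt (pi * r) * Gamma (r / 2) \<noteq> 0"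
        by (rule less_imp_neq[THEN not_sym])
      then show ?thesis
        unfolding inverse_eq_divide[symmetric] by (rule Fields.field_class.field_inverse)
    qed
    finally show ?thesis .
  next
    case PInf
    then show ?thesis
      by (simp add: student_density_def nn_integral_eq_integral)
  qed (use assms in simp)
qed simp

section \<open>Lower tails of densities\<close>

lemma set_integrable_lborel:
  fixes f :: "real \<Rightarrow> real"
  assumes "integrable lborel f" and "A \<in> sets borel"
  shows "set_integrable lborel A f"
  using assms unfolding set_integrable_def by (intro integrable_mult_indicator) auto

lemma lower_tail_has_real_derivative:
  fixes f :: "real \<Rightarrow> real"
  assumes "integrable lborel f" and "continuous_on UNIV f"
  shows "((\<lambda>x. LINT u:{..x}|lborel. f u) has_real_derivative f x) (at x)"
proof -
  have split: "(LINT u:{..y}|lborel. f u) = (LINT u:{..<x - 1}|lborel. f u) + integral {x - 1..y} f"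
    if "x - 1 \<le> y" for y
  proof -
    have "{..y} = {..<x - 1} \<union> {x - 1..y}"
      using that by auto
    moreover have "(LINT u:{..<x - 1} \<union> {x - 1..y}|lborel. f u)
        = (LINT u:{..<x - 1}|lborel. f u) + (LINT u:{x - 1..y}|lborel. f u)"
      using assms by (intro set_integral_Un set_integrable_lborel) auto
    moreover have "(LINT u:{x - 1..y}|lborel. f u) = integral {x - 1..y} f"
      using assms by (intro set_borel_integral_eq_integral(2) set_integrable_lborel) auto
    ultimately show ?thesis
      by simp
  qed
  have "((\<lambda>y. integral {x - 1..y} f) has_real_derivative f x) (at x within {x - 1..x + 1})"
    using continuous_on_subset[OF assms(2)] by (intro integral_has_real_derivative) auto
  moreover have "at x within {x - 1..x + 1} = at x"
    by (intro at_within_interior) auto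
  ultimately have "((\<lambda>y. (LINT u:{..<x - 1}|lborel. f u) + integral {x - 1..y} f) has_real_derivative f x) (at x)"
    by (auto intro!: derivative_eq_intros)
  moreover have "\<forall>\<^sub>F y in nhds x. (LINT u:{..y}|lborel. f u)
      = (LINT u:{..<x - 1}|lborel. f u) + integral {x - 1..y} f"
    using eventually_nhds_in_open[OF open_greaterThan, of x "x - 1"]
    by (auto elim!: eventually_mono simp: split)
  ultimately show ?thesis
    by (subst DERIV_cong_ev[OF refl _ refl]) 
qed

lemma lower_tail_eq_diff_upper_tail:
  fixes f :: "real \<Rightarrow> real"
  assumes "integrable lborel f"
  shows "(LINT u:{..x}|lborel. f u) = (LINT u|lborel. f u) - (LINT u:{x<..}|lborel. f u)"
proof -
  have "(LINT u:{..x} \<union> {x<..}|lborel. f u) = (LINT u:{..x}|lborel. f u) + (LINT u:{x<..}|lborel. f u)"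
    using assms by (intro set_integral_Un set_integrable_lborel) auto
  moreover have "{..x} \<union> {x<..} = UNIV"
    by auto
  ultimately show ?thesis
    by (simp add: set_lebesgue_integral_def)
qed

lemma lower_tail_minus_even:
  fixes f :: "real \<Rightarrow> real"
  assumes "integrable lborel f" and even: "\<And>x. f (- x) = f x"
  shows "(LINT u:{..- x}|lborel. f u) = (LINT u|lborel. f u) - (LINT u:{..x}|lborel. f u)"
proof -
  have "(LINT u:{..- x}|lborel. f u) = (LINT u|lborel. indicator {..- x} (0 + - 1 * u) *\<^sub>R f (0 + - 1 * u))"
    unfolding set_lebesgue_integral_def
    by (subst lborel_integral_real_affine[where c = "- 1" and t = 0]) auto
  also have "\<dots> = (LINT u:{x<..}|lborel. f u)"
    unfolding set_lebesgue_integral_def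
  proof (intro integral_cong_AE)
    show "AE u in lborel. indicator {..- x} (0 + - 1 * u) *\<^sub>R f (0 + - 1 * u) = indicator {x<..} u *\<^sub>R f u"
      using AE_lborel_singleton[of x] by eventually_elim (auto simp: indicator_def even)
  qed (use assms in auto)
  finally show ?thesis
    using lower_tail_eq_diff_upper_tail[OF assms(1), of x] by simp
qed

section \<open>Symmetric densities that cross once\<close>

text \<open>The relation between the two distances uses nothing but symmetry, equal mass and the sign pattern
  of \<open>g - f\<close>; the normal density then needs no separate treatment.\<close>

locale symmetric_pair =
  fixes f g :: "real \<Rightarrow> real"
  assumes f: "integrable lborel f" "continuous_on UNIV f" "\<And>x. f (- x) = f x"
    and g: "integrable lborel g" "continuous_on UNIV g" "\<And>x. g (- x) = g x"
    and same_mass: "(LINT u|lborel. f u) = (LINT u|lborel. g u)"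
begin

definition gap :: "real \<Rightarrow> real" where
  "gap x = (LINT u:{..x}|lborel. g u) - (LINT u:{..x}|lborel. f u)"

lemma gap_has_real_derivative: "(gap has_real_derivative g x - f x) (at x)"
  unfolding gap_def[abs_def] using f g
  by (auto intro!: derivative_eq_intros lower_tail_has_real_derivative)

lemma gap_minus: "gap (- x) = - gap x"
  using f g by (simp add: gap_def lower_tail_minus_even same_mass)

lemma gap_0: "gap 0 = 0"
  using gap_minus[of 0] by simp

text \<open>Seen from the right, the gap is determined by the signs of \<open>f - g\<close> beyond \<open>x\<close>; this replaces
  any discussion of limits at infinity.\<close>

lemma gap_eq_upper_tail: "gap x = (LINT u:{x<..}|lborel. f u - g u)"
proof -
  have "set_integrable lborel {x<..} f" "set_integrable lborel {x<..} g"
    using f g by (auto intro!: set_integrable_lborel)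
  then show ?thesis
    using f g by (simp add: gap_def lower_tail_eq_diff_upper_tail same_mass)
qed

lemma gap_nonneg_of_tail:
  assumes "\<And>u. x < u \<Longrightarrow> g u \<le> f u"
  shows "0 \<le> gap x"
  unfolding gap_eq_upper_tail set_lebesgue_integral_def
  using assms by (intro Bochner_Integration.integral_nonneg) (auto simp: indicator_def)

lemma gap_nonpos_of_tail:
  assumes "\<And>u. x < u \<Longrightarrow> f u \<le> g u"
  shows "gap x \<le> 0"
proof -
  have "(LINT u:{x<..}|lborel. f u - g u) \<le> (LINT u:{x<..}|lborel. 0)"
    using assms f g by (intro set_integral_mono set_integrable_lborel) auto
  then show ?thesis
    by (simp add: gap_eq_upper_tail)
qed

lemma gap_mono:
  assumes "x \<le> y" and "\<And>u. x \<le> u \<Longrightarrow> u \<le> y \<Longrightarrow> f u \<le> g u"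
  shows "gap x \<le> gap y"
  using assms
  by (intro DERIV_nonneg_imp_nondecreasing[of x y gap]) (auto intro!: exI gap_has_real_derivative)

lemma gap_antimono:
  assumes "x \<le> y" and "\<And>u. x \<le> u \<Longrightarrow> u \<le> y \<Longrightarrow> g u \<le> f u"
  shows "gap y \<le> gap x"
  using assms
  by (intro DERIV_nonpos_imp_nonincreasing[of x y gap]) (auto intro!: exI gap_has_real_derivative)

text \<open>Otherwise the gap would be nonpositive to the right of \<open>0\<close> by its upper tails, although it starts
  at \<open>0\<close> with positive slope.\<close>

lemma exists_greater_of_less_at_0:
  assumes "f 0 < g 0"
  shows "\<exists>x>0. g x < f x"
proof (rule ccontr)
  assume "\<not> ?thesis"
  then have le: "f x \<le> g x" if "0 < x" for x
    using that by (meson not_less)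
  obtain h where "0 < h" and "gap 0 < gap (0 + h)"
    using DERIV_pos_inc_right[OF gap_has_real_derivative[of 0]] assms by (metis diff_gt_0_iff_gt field_sum_of_halves half_gt_zero less_add_same_cancel2)
  moreover have "gap h \<le> 0"
    using \<open>0 < h\<close> le by (intro gap_nonpos_of_tail) auto
  ultimately show False
    by (simp add: gap_0)
qed

context
  fixes c :: real
  assumes c: "0 < c"
    and inner: "\<And>x. 0 \<le> x \<Longrightarrow> x \<le> c \<Longrightarrow> f x \<le> g x"
    and outer: "\<And>x. c \<le> x \<Longrightarrow> g x \<le> f x"
begin

lemma gap_nonneg:
  assumes "0 \<le> x"
  shows "0 \<le> gap x"
proof (cases "x \<le> c")
  case True
  then show ?thesis
    using gap_mono[of 0 x] assms inner by (simp add: gap_0)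
next
  case False
  then show ?thesis
    using outer by (intro gap_nonneg_of_tail) auto
qed

lemma abs_gap_le: "\<bar>gap x\<bar> \<le> gap c"
proof -
  have *: "\<bar>gap y\<bar> \<le> gap c" if "0 \<le> y" for y
    using that gap_nonneg[OF that] gap_mono[of y c] gap_antimono[of c y] inner outer
    by (cases "y \<le> c") auto
  show ?thesis
    using *[of x] *[of "- x"] by (cases "0 \<le> x") (auto simp: gap_minus)
qed

lemma SUP_abs_gap: "(SUP x. \<bar>gap x\<bar>) = gap c"
proof (rule antisym)
  show "(SUP x. \<bar>gap x\<bar>) \<le> gap c"
    by (intro cSUP_least) (auto intro: abs_gap_le)
  have "\<bar>gap c\<bar> \<le> (SUP x. \<bar>gap x\<bar>)"
    by (intro cSUP_upper bdd_aboveI[of _ "gap c"]) (auto intro: abs_gap_le)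
  then show "gap c \<le> (SUP x. \<bar>gap x\<bar>)"
    by simp
qed

lemma integral_abs_diff: "(LINT x|lborel. \<bar>f x - g x\<bar>) = 4 * gap c"
proof -
  have even: "f \<bar>x\<bar> = f x" "g \<bar>x\<bar> = g x" for x
    using f(3) g(3) by (auto simp: abs_if)
  define I where "I A x = indicator A x *\<^sub>R (g x - f x)" for A and x :: real
  have int: "integrable lborel (I A)" if "A \<in> sets borel" for A
    unfolding I_def using f g that by (intro integrable_mult_indicator) auto
  have lower: "integral\<^sup>L lborel (I {..y}) = gap y" for y
  proof -
    have "set_integrable lborel {..y} f" "set_integrable lborel {..y} g"
      using f g by (auto intro!: set_integrable_lborel)
    then show ?thesis
      unfolding I_def gap_def set_lebesgue_integral_def[symmetric] by simp
  qed
  \<comment> \<open>On \<open>(- c, c]\<close> the integrand is \<open>g - f = 2 * (g - f) - (g - f)\<close>; elsewhere it is \<open>- (g - f)\<close>.\<close>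
  have "\<bar>f x - g x\<bar> = 2 * (I {..c} x - I {..- c} x) - I UNIV x" for x
  proof (cases "\<bar>x\<bar> \<le> c")
    case True
    then show ?thesis
      using inner[of "\<bar>x\<bar>"] outer[of "\<bar>x\<bar>"] by (auto simp: I_def indicator_def even)
  next
    case False
    then show ?thesis
      using c outer[of "\<bar>x\<bar>"] by (auto simp: I_def indicator_def even)
  qed
  then have "(LINT x|lborel. \<bar>f x - g x\<bar>) = 2 * (gap c - gap (- c)) - integral\<^sup>L lborel (I UNIV)"
    using int by (simp add: lower)
  also have "integral\<^sup>L lborel (I UNIV) = 0"
    using f(1) g(1) by (simp add: I_def[abs_def] same_mass)
  finally show ?thesis
    by (simp add: gap_minus)
qed

end

end

section \<open>Crossings of Student densities\<close>

lemma student_log_density_0_less: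
  assumes "0 < p" and "p < q"
  shows "student_log_density p 0 < student_log_density q 0"
proof -
  obtain r where r: "p = ereal r" "0 < r"
    using assms by (cases p) auto
  show ?thesis
  proof (cases q)
    case (real s)
    then show ?thesis
      using r assms ln_gamma_half_step_strict_mono[of "r / 2" "s / 2"]
      by (simp add: student_log_density_def)
  next
    case PInf
    then show ?thesis
      using r ln_gamma_half_step_neg[of "r / 2"] by (simp add: student_log_density_def)
  qed (use assms in simp)
qed

text \<open>For finite \<open>q\<close> the numerator factors as \<open>(q - p) * (t - 1)\<close>, so the position of the turning point
  does not depend on \<open>p\<close> and \<open>q\<close>.\<close>

lemma student_log_density_diff_derivative:
  assumes "0 < p" and "p < q" and "0 \<le> t"
  shows "\<exists>k\<ge>0. ((\<lambda>t. student_log_density p t - student_log_density q t)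
           has_real_derivative k * (t - 1)) (at t)"
proof -
  obtain r where r: "p = ereal r" "0 < r"
    using assms by (cases p) auto
  have pos: "0 < 1 + t / s" "0 < t + s" if "0 < s" for s
    using that assms by (auto simp: add_pos_nonneg)
  show ?thesis
  proof (cases q)
    case (real s)
    then have s: "r < s" "0 < s"
      using assms r by auto
    have "((\<lambda>t. student_log_density p t - student_log_density q t)
        has_real_derivative (s - r) / (2 * (t + r) * (t + s)) * (t - 1)) (at t)"
      using r s pos[of r] pos[of s] unfolding real r student_log_density_def Let_def
      by (auto intro!: derivative_eq_intros simp: divide_simps) (simp add: algebra_simps)
    moreover have "0 \<le> (s - r) / (2 * (t + r) * (t + s))"
      using r s pos[of r] pos[of s] by (intro divide_nonneg_pos mult_pos_pos) auto
    ultimately show ?thesis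
      by blast
  next
    case PInf
    have "((\<lambda>t. student_log_density p t - student_log_density q t)
        has_real_derivative 1 / (2 * (t + r)) * (t - 1)) (at t)"
      using r pos[of r] unfolding PInf r student_log_density_def Let_def
      by (auto intro!: derivative_eq_intros simp: divide_simps) (simp add: algebra_simps)
    moreover have "0 \<le> 1 / (2 * (t + r))"
      using r assms(3) by simp
    ultimately show ?thesis
      by blast
  qed (use assms in simp)
qed

lemma symmetric_pair_student:
  assumes "0 < p" and "0 < q"
  shows "symmetric_pair (student_density p) (student_density q)"
proof
  show "student_density p (- x) = student_density p x" "student_density q (- x) = student_density q x" for x
    using assms by (simp_all add: student_density_eq_exp)
qed (use student_density_has_integral[OF assms(1)] student_density_has_integral[OF assms(2)]
       student_density_continuous[OF assms(1)] student_density_continuous[OF assms(2)]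
     in \<open>simp_all add: has_bochner_integral_iff\<close>)

text \<open>The logarithm \<open>h\<close> of the ratio is negative at \<open>0\<close>, falls up to \<open>t = 1\<close> and rises from there.  It
  becomes positive somewhere because the masses agree, so it has a zero \<open>t \<ge> 1\<close> and \<open>c = sqrt t\<close>.\<close>

lemma student_densities_cross_once:
  assumes "0 < p" and "p < q"
  shows "\<exists>c>0. (\<forall>x. 0 \<le> x \<longrightarrow> x \<le> c \<longrightarrow> student_density p x \<le> student_density q x)
             \<and> (\<forall>x\<ge>c. student_density q x \<le> student_density p x)"
proof -
  define h where "h t = student_log_density p t - student_log_density q t" for t
  have "0 < q"
    using assms by simp
  then interpret symmetric_pair "student_density p" "student_density q"
    using assms(1) by (intro symmetric_pair_student)
  have le_iff: "student_density p x \<le> student_density q x \<longleftrightarrow> h (x\<^sup>2) \<le> 0"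
    "student_density q x \<le> student_density p x \<longleftrightarrow> 0 \<le> h (x\<^sup>2)" for x
    using assms \<open>0 < q\<close> by (auto simp: student_density_eq_exp h_def)
  have deriv: "\<exists>k\<ge>0. (h has_real_derivative k * (t - 1)) (at t)" if "0 \<le> t" for t
    using student_log_density_diff_derivative[OF assms that] unfolding h_def[abs_def] .
  have h0: "h 0 < 0"
    using student_log_density_0_less[OF assms] by (simp add: h_def)
  have decr: "h t \<le> h 0" if "0 \<le> t" "t \<le> 1" for t
  proof (rule DERIV_nonpos_imp_nonincreasing[OF that(1)])
    fix u assume "0 \<le> u" "u \<le> t"
    then show "\<exists>y. (h has_real_derivative y) (at u) \<and> y \<le> 0"
      using deriv[of u] that by (metis diff_le_0_iff_le mult_nonneg_nonpos order_trans)
  qed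
  have incr: "h s \<le> h t" if "1 \<le> s" "s \<le> t" for s t
  proof (rule DERIV_nonneg_imp_nondecreasing[OF that(2)])
    fix u assume "s \<le> u" "u \<le> t"
    then show "\<exists>y. (h has_real_derivative y) (at u) \<and> 0 \<le> y"
      using deriv[of u] that by (metis diff_ge_0_iff_ge mult_nonneg_nonneg order_trans zero_le_one)
  qed
  have "student_density p 0 < student_density q 0"
    using h0 le_iff(2)[of 0] by simp
  then obtain x where x: "0 < x" "student_density q x < student_density p x"
    using exists_greater_of_less_at_0 by blast
  then have hx: "0 < h (x\<^sup>2)"
    using le_iff(1)[of x] by simp
  then have "1 \<le> x\<^sup>2"
    using decr[of "x\<^sup>2"] h0 by (cases "x\<^sup>2 \<le> 1") auto
  moreover have "h 1 \<le> 0"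
    using decr[of 1] h0 by simp
  moreover have "continuous_on {1..x\<^sup>2} h"
    by (intro continuous_at_imp_continuous_on ballI) (metis deriv DERIV_isCont atLeastAtMost_iff order_trans zero_le_one)
  ultimately obtain t where t: "1 \<le> t" "h t = 0"
    using IVT'[of h 1 0 "x\<^sup>2"] hx by auto
  show ?thesis
  proof (intro exI[of _ "sqrt t"] conjI allI impI)
    show "0 < sqrt t"
      using t by simp
  next
    fix y assume "0 \<le> y" "y \<le> sqrt t"
    then have "y\<^sup>2 \<le> t"
      using t by (metis abs_of_nonneg order_trans real_sqrt_abs real_sqrt_le_iff)
    then have "h (y\<^sup>2) \<le> 0"
      using decr[of "y\<^sup>2"] incr[of "y\<^sup>2" t] t h0 by (cases "y\<^sup>2 \<le> 1") auto
    then show "student_density p y \<le> student_density q y"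
      by (simp add: le_iff)
  next
    fix y assume "sqrt t \<le> y"
    then have "t \<le> y\<^sup>2"
      using t by (metis real_sqrt_ge_zero real_sqrt_pow2 power_mono order_trans zero_le_one)
    then have "0 \<le> h (y\<^sup>2)"
      using incr[of t "y\<^sup>2"] t by simp
    then show "student_density q y \<le> student_density p y"
      by (simp add: le_iff)
  qed
qed

lemma half_d_TV_eq_d_Ko:
  assumes "0 < p" and "p < q"
  shows "1 / 2 * d_TV p q = d_Ko p q"
proof -
  have "0 < q"
    using assms by simp
  then interpret symmetric_pair "student_density p" "student_density q"
    using assms(1) by (intro symmetric_pair_student)
  obtain c where c: "0 < c"
    "\<And>x. 0 \<le> x \<Longrightarrow> x \<le> c \<Longrightarrow> student_density p x \<le> student_density q x"
    "\<And>x. c \<le> x \<Longrightarrow> student_density q x \<le> student_density p x"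
    using student_densities_cross_once[OF assms] by blast
  have "d_Ko p q = (SUP x. \<bar>gap x\<bar>)"
    by (simp add: d_Ko_def student_cdf_def gap_def abs_minus_commute)
  then show ?thesis
    using SUP_abs_gap[OF c] integral_abs_diff[OF c] by (simp add: d_TV_def)
qed

lemma student_cdf_mono:
  assumes "0 < p" and "p \<le> q" and "0 \<le> x"
  shows "student_cdf p x \<le> student_cdf q x"
proof (cases "p = q")
  case False
  then have less: "p < q" and "0 < q"
    using assms by auto
  then interpret symmetric_pair "student_density p" "student_density q"
    using assms(1) by (intro symmetric_pair_student)
  obtain c where c: "0 < c"
    "\<And>x. 0 \<le> x \<Longrightarrow> x \<le> c \<Longrightarrow> student_density p x \<le> student_density q x"
    "\<And>x. c \<le> x \<Longrightarrow> student_density q x \<le> student_density p x"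
    using student_densities_cross_once[OF assms(1) less] by blast
  show ?thesis
    using gap_nonneg[OF c assms(3)] by (simp add: student_cdf_def gap_def)
qed simp

lemma d_Ko_attained:
  assumes "0 < p" and "p < q"
  shows "\<exists>c>0. d_Ko p q = student_cdf q c - student_cdf p c"
proof -
  have "0 < q"
    using assms by simp
  then interpret symmetric_pair "student_density p" "student_density q"
    using assms(1) by (intro symmetric_pair_student)
  obtain c where c: "0 < c"
    "\<And>x. 0 \<le> x \<Longrightarrow> x \<le> c \<Longrightarrow> student_density p x \<le> student_density q x"
    "\<And>x. c \<le> x \<Longrightarrow> student_density q x \<le> student_density p x"
    using student_densities_cross_once[OF assms] by blast
  have "d_Ko p q = (SUP x. \<bar>gap x\<bar>)"
    by (simp add: d_Ko_def student_cdf_def gap_def abs_minus_commute)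
  then show ?thesis
    using SUP_abs_gap[OF c] c by (auto simp: student_cdf_def gap_def)
qed

section \<open>Positivity of polynomials by Horner bounds\<close>

text \<open>Horner's scheme on \<open>{0..w}\<close> with every partial value replaced by a lower bound: a nonnegative partial
  bound is multiplied by the least factor \<open>0\<close>, a negative one by the greatest factor \<open>w\<close>.\<close>

fun horner_lower :: "real \<Rightarrow> real list \<Rightarrow> real" where
  "horner_lower w [] = 0"
| "horner_lower w (c # cs) = c + min 0 (w * horner_lower w cs)"

lemma horner_lower:
  assumes "0 \<le> v" and "v \<le> w"
  shows "horner_lower w cs \<le> horner_sum (\<lambda>c. c) v cs"
proof (induction cs)
  case (Cons c cs)
  have "min 0 (w * horner_lower w cs) \<le> v * horner_lower w cs"
  proof (cases "0 \<le> horner_lower w cs")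
    case False
    then have "w * horner_lower w cs \<le> v * horner_lower w cs"
      using assms by (intro mult_right_mono_neg) auto
    then show ?thesis
      by simp
  qed (use assms in \<open>auto intro: min.coboundedI1\<close>)
  also have "\<dots> \<le> v * horner_sum (\<lambda>c. c) v cs"
    using assms Cons by (intro mult_left_mono)
  finally show ?case
    by simp
qed simp

text \<open>The coefficients of \<open>c + (h + X) * r\<close>, constant term first; the recursion step of a Taylor shift.\<close>

fun cons_mult_linear :: "real \<Rightarrow> real \<Rightarrow> real list \<Rightarrow> real list" where
  "cons_mult_linear h c [] = [c]"
| "cons_mult_linear h c (r # rs) = (c + h * r) # cons_mult_linear h r rs"

fun taylor_shift :: "real \<Rightarrow> real list \<Rightarrow> real list" where
  "taylor_shift h [] = []"
| "taylor_shift h (c # cs) = cons_mult_linear h c (taylor_shift h cs)"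

lemma horner_sum_cons_mult_linear:
  "horner_sum (\<lambda>c. c) v (cons_mult_linear h c rs) = c + (h + v) * horner_sum (\<lambda>c. c) v rs"
  by (induction h c rs rule: cons_mult_linear.induct) (auto simp: algebra_simps)

lemma horner_sum_taylor_shift: "horner_sum (\<lambda>c. c) v (taylor_shift h cs) = horner_sum (\<lambda>c. c) (h + v) cs"
  by (induction cs) (auto simp: horner_sum_cons_mult_linear)

text \<open>Polynomials in two variables are lists, by powers of \<open>a\<close>, of coefficient lists in \<open>t\<close>.  The inner
  lists are bounded on a strip of \<open>t\<close>, the outer one on \<open>{0..b}\<close>.\<close>

lemma horner_sum_lower_box:
  assumes "0 \<le> a" "a \<le> b" "h \<le> t" "t \<le> h + w"
  shows "horner_lower b (map (\<lambda>cs. horner_lower w (taylor_shift h cs)) css)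
           \<le> horner_sum (horner_sum (\<lambda>c. c) t) a css"
proof -
  have inner: "horner_lower w (taylor_shift h cs) \<le> horner_sum (\<lambda>c. c) t cs" for cs
    using horner_lower[of "t - h" w "taylor_shift h cs"] assms by (simp add: horner_sum_taylor_shift)
  have "horner_lower b (map (\<lambda>cs. horner_lower w (taylor_shift h cs)) css)
      \<le> horner_sum (\<lambda>c. c) a (map (\<lambda>cs. horner_lower w (taylor_shift h cs)) css)"
    using assms by (intro horner_lower)
  also have "\<dots> \<le> horner_sum (horner_sum (\<lambda>c. c) t) a css"
    using assms inner by (induction css) (auto intro!: add_mono mult_left_mono)
  finally show ?thesis .
qed

text \<open>The cofactor of \<open>a ^ 3 / 384\<close> in \<open>remainder_identity\<close>, with powers of \<open>a\<close> outside and powers of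
  \<open>t\<close> inside.\<close>

definition remainder_coeffs :: "real list list" where
  "remainder_coeffs =
  [[32, 54, - 53, - 92, 113, - 22, 1],
   [123 / 16, 27, 5 / 2, - 79 / 2, 653 / 8, - 339 / 10, - 203 / 12, 13 / 2, - 9 / 16],
   [9 / 8, 111 / 16, 175 / 32, - 5 / 8, 575 / 32, - 821 / 15, 257 / 48, 421 / 12, - 1291 / 96,
     31 / 16, - 3 / 32],
   [115 / 128, 69 / 64, - 1461 / 128, - 1389 / 64, 8959 / 768, 64 / 3, 799 / 48, - 11299 / 672,
     - 8317 / 768, 9187 / 1728, - 437 / 384, 7 / 64, - 1 / 256],
   [759 / 1024, 69 / 16, 3861 / 512, 353 / 128, - 887 / 1536, - 157 / 48, - 5999 / 768,
     - 16365 / 896, - 29063 / 9216, 325 / 768, - 5 / 256],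
   [- 363 / 4096, - 693 / 1024, - 4835 / 2048, - 3013 / 1024, 22271 / 12288, 1655 / 512,
     - 1195 / 512, 575 / 1152, - 25 / 768],
   [1331 / 16384, 1815 / 4096, 2695 / 4096, - 25 / 512, - 1225 / 3072, 125 / 768, - 125 / 6912]]"

text \<open>Over the whole range of \<open>t\<close> the Horner bound is too weak, because the Taylor coefficients at \<open>0\<close>
  have mixed signs and are estimated one by one.  The eight strips are short enough for it to be
  positive on each.\<close>

lemma remainder_pos:
  assumes "0 \<le> a" "a \<le> 1 / 4" "0 \<le> t" "t \<le> 31 / 10"
  shows "0 < horner_sum (horner_sum (\<lambda>c. c) t) a remainder_coeffs"
proof -
  have box: "0 < horner_sum (horner_sum (\<lambda>c. c) t) a remainder_coeffs"
    if "0 < horner_lower (1 / 4) (map (\<lambda>cs. horner_lower w (taylor_shift h cs)) remainder_coeffs)"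
      and "h \<le> t" "t \<le> h + w" for h w
    using horner_sum_lower_box[of a "1 / 4" h t w remainder_coeffs] assms that by linarith
  have "0 < horner_lower (1 / 4)
      (map (\<lambda>cs. horner_lower (3 / 4) (taylor_shift 0 cs)) remainder_coeffs)"
    by (simp add: remainder_coeffs_def)
  note box0_1 = box[OF this]
  have "0 < horner_lower (1 / 4)
      (map (\<lambda>cs. horner_lower (4 / 5) (taylor_shift (3 / 4) cs)) remainder_coeffs)"
    by (simp add: remainder_coeffs_def)
  note box3_4 = box[OF this]
  have "0 < horner_lower (1 / 4)
      (map (\<lambda>cs. horner_lower (2 / 5) (taylor_shift (31 / 20) cs)) remainder_coeffs)"
    by (simp add: remainder_coeffs_def)
  note box31_20 = box[OF this]
  have "0 < horner_lower (1 / 4)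
      (map (\<lambda>cs. horner_lower (7 / 20) (taylor_shift (39 / 20) cs)) remainder_coeffs)"
    by (simp add: remainder_coeffs_def)
  note box39_20 = box[OF this]
  have "0 < horner_lower (1 / 4)
      (map (\<lambda>cs. horner_lower (3 / 10) (taylor_shift (23 / 10) cs)) remainder_coeffs)"
    by (simp add: remainder_coeffs_def)
  note box23_10 = box[OF this]
  have "0 < horner_lower (1 / 4)
      (map (\<lambda>cs. horner_lower (1 / 4) (taylor_shift (13 / 5) cs)) remainder_coeffs)"
    by (simp add: remainder_coeffs_def)
  note box13_5 = box[OF this]
  have "0 < horner_lower (1 / 4)
      (map (\<lambda>cs. horner_lower (3 / 20) (taylor_shift (57 / 20) cs)) remainder_coeffs)"
    by (simp add: remainder_coeffs_def)
  note box57_20 = box[OF this]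
  have "0 < horner_lower (1 / 4)
      (map (\<lambda>cs. horner_lower (1 / 10) (taylor_shift 3 cs)) remainder_coeffs)"
    by (simp add: remainder_coeffs_def)
  note box3_1 = box[OF this]
  show ?thesis
    using assms box0_1 box3_4 box31_20 box39_20 box23_10 box13_5 box57_20 box3_1
    by linarith
qed

section \<open>Lower bound for the density ratio\<close>

text \<open>The derivative of the difference is \<open>y ^ 3 / (1 + y)\<close>, so the bound holds on both sides of \<open>0\<close>.\<close>

lemma ln_one_plus_le_cubic:
  fixes y :: real
  assumes "- 1 < y"
  shows "ln (1 + y) \<le> y - y\<^sup>2 / 2 + y ^ 3 / 3"
proof -
  define D where "D y = y - y\<^sup>2 / 2 + y ^ 3 / 3 - ln (1 + y)" for y :: real
  have deriv: "(D has_real_derivative u ^ 3 / (1 + u)) (at u)" if "- 1 < u" for u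
    using that unfolding D_def
    by (auto intro!: derivative_eq_intros simp: field_simps power2_eq_square power3_eq_cube)
  have "D 0 \<le> D y"
  proof (cases "0 \<le> y")
    case True
    then show ?thesis
    proof (rule DERIV_nonneg_imp_nondecreasing)
      fix u assume "0 \<le> u" "u \<le> y"
      then show "\<exists>z. (D has_real_derivative z) (at u) \<and> 0 \<le> z"
        by (intro exI[of _ "u ^ 3 / (1 + u)"] conjI deriv) simp_all
    qed
  next
    case False
    then have "y \<le> 0"
      by simp
    then show ?thesis
    proof (rule DERIV_nonpos_imp_nonincreasing)
      fix u assume "y \<le> u" "u \<le> 0"
      then show "\<exists>z. (D has_real_derivative z) (at u) \<and> z \<le> 0"
        using assms
        by (intro exI[of _ "u ^ 3 / (1 + u)"] conjI deriv divide_nonpos_pos) (simp_all add: power_le_zero_eq)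
    qed
  qed
  then show ?thesis
    by (simp add: D_def)
qed

text \<open>In the comparison of densities \<open>s = a * t\<close> can be as large as \<open>0.775\<close>; the Taylor polynomial of
  degree 5, the next lower one that bounds the logarithm from above, is too coarse there.\<close>

lemma ln_one_plus_le_degree7:
  fixes s :: real
  assumes "0 \<le> s"
  shows "ln (1 + s) \<le> s - s\<^sup>2 / 2 + s ^ 3 / 3 - s ^ 4 / 4 + s ^ 5 / 5 - s ^ 6 / 6 + s ^ 7 / 7"
proof -
  define D where "D s = s - s\<^sup>2 / 2 + s ^ 3 / 3 - s ^ 4 / 4 + s ^ 5 / 5 - s ^ 6 / 6 + s ^ 7 / 7 - ln (1 + s)"
    for s :: real
  have deriv: "(D has_real_derivative u ^ 7 / (1 + u)) (at u)" if "0 \<le> u" for u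
    using that unfolding D_def
    by (auto intro!: derivative_eq_intros simp: divide_simps) (simp add: algebra_simps power_numeral_reduce)
  have "D 0 \<le> D s"
    using assms
  proof (rule DERIV_nonneg_imp_nondecreasing)
    fix u assume "0 \<le> u" "u \<le> s"
    then show "\<exists>z. (D has_real_derivative z) (at u) \<and> 0 \<le> z"
      by (intro exI[of _ "u ^ 7 / (1 + u)"] conjI deriv) simp_all
  qed
  then show ?thesis
    by (simp add: D_def)
qed

definition P_sq :: "real \<Rightarrow> real \<Rightarrow> real" where
  "P_sq a t = - 96 * (t\<^sup>2 - 2 * t - 1) - 4 * a * (3 * t ^ 4 - 28 * t ^ 3 + 30 * t\<^sup>2 + 12 * t + 3)
     - a\<^sup>2 * (20 * t\<^sup>2 - 60 * t - 33)"

lemma P_poly_eq_P_sq: "P_poly a x = P_sq a (x\<^sup>2)"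
  by (simp add: P_poly_def P_sq_def power_mult[symmetric])

text \<open>With \<open>y = - a P / 384\<close>, the left-hand side compares Taylor bounds for the logarithms of \<open>f\<^sub>p / \<phi>\<close>
  and \<open>1 + y\<close>.  Everything below order \<open>a ^ 3\<close> cancels because \<open>P\<close> contains the expansion of the
  density ratio to that order.\<close>

lemma remainder_identity:
  fixes a t :: real
  defines "y \<equiv> - a * P_sq a t / 384"
  shows "- a / 4 + t / 2 - (1 + a) / 2 * (t - a * t\<^sup>2 / 2 + a\<^sup>2 * t ^ 3 / 3 - a ^ 3 * t ^ 4 / 4
            + a ^ 4 * t ^ 5 / 5 - a ^ 5 * t ^ 6 / 6 + a ^ 6 * t ^ 7 / 7)
          - (y - y\<^sup>2 / 2 + y ^ 3 / 3)
         = a ^ 3 / 384 * horner_sum (horner_sum (\<lambda>c. c) t) a remainder_coeffs"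
    (is "?lhs = _")
proof -
  define m0 where "m0 = (t\<^sup>2 - 2 * t - 1) / 4"
  define m1 where "m1 = (3 * t ^ 4 - 28 * t ^ 3 + 30 * t\<^sup>2 + 12 * t + 3) / 96"
  define m2 where "m2 = (20 * t\<^sup>2 - 60 * t - 33) / 384"
  note m_defs = m0_def m1_def m2_def
  have y: "y = a * (m0 + a * (m1 + a * m2))"
    by (simp add: y_def P_sq_def m_defs field_simps power2_eq_square)
  have collect: "a * 0 + a\<^sup>2 * 0 + a ^ 3 * (h l0 / 384)
      + a ^ 4 * (h l1 / 384)
      + a ^ 5 * (h l2 / 384)
      + a ^ 6 * (h l3 / 384)
      + a ^ 7 * (h l4 / 384)
      + a ^ 8 * (h l5 / 384)
      + a ^ 9 * (h l6 / 384)
      = a ^ 3 / 384 * horner_sum h a [l0, l1, l2, l3, l4, l5, l6]" for h :: "real list \<Rightarrow> real" and l0 l1 l2 l3 l4 l5 l6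
    by (simp add: field_simps power2_eq_square power_numeral_reduce)
  \<comment> \<open>\<open>y = a m0 + a\<^sup>2 m1 + a\<^sup>3 m2\<close>; sorting by powers of \<open>a\<close> leaves identities in \<open>t\<close> alone.\<close>
  have expansion: "?lhs = a * (- 1 / 4 - t / 2 + t\<^sup>2 / 4 - m0) + a\<^sup>2 * (- m1 + m0\<^sup>2 / 2 + (t\<^sup>2 / 4 - t ^ 3 / 6))
      + a ^ 3 * (- m2 + m0 * m1 - m0 ^ 3 / 3 + (t ^ 4 / 8 - t ^ 3 / 6))
      + a ^ 4 * (m1\<^sup>2 / 2 + m0 * m2 - m0\<^sup>2 * m1 + (t ^ 4 / 8 - t ^ 5 / 10))
      + a ^ 5 * (m1 * m2 - m0\<^sup>2 * m2 - m0 * m1\<^sup>2 + (t ^ 6 / 12 - t ^ 5 / 10))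
      + a ^ 6 * (m2\<^sup>2 / 2 - 2 * m0 * m1 * m2 - m1 ^ 3 / 3 + (t ^ 6 / 12 - t ^ 7 / 14))
      + a ^ 7 * (- m0 * m2\<^sup>2 - m1\<^sup>2 * m2 - t ^ 7 / 14)
      + a ^ 8 * (- m1 * m2\<^sup>2)
      + a ^ 9 * (- (m2 ^ 3) / 3)"
    unfolding y by (simp add: field_simps power2_eq_square power_numeral_reduce)
  have coeffs0: "- 1 / 4 - t / 2 + t\<^sup>2 / 4 - m0 = 0"
    by (simp add: m_defs field_simps)
  have coeffs1: "- m1 + m0\<^sup>2 / 2 + (t\<^sup>2 / 4 - t ^ 3 / 6) = 0"
    by (simp add: m_defs field_simps power2_eq_square power_numeral_reduce)
  have coeffs2: "- m2 + m0 * m1 - m0 ^ 3 / 3 + (t ^ 4 / 8 - t ^ 3 / 6)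
      = horner_sum (\<lambda>c. c) t [32, 54, - 53, - 92, 113, - 22, 1] / 384"
    by (simp add: m_defs field_simps power2_eq_square power_numeral_reduce)
  have coeffs3: "m1\<^sup>2 / 2 + m0 * m2 - m0\<^sup>2 * m1 + (t ^ 4 / 8 - t ^ 5 / 10)
      = horner_sum (\<lambda>c. c) t [123 / 16, 27, 5 / 2, - 79 / 2, 653 / 8, - 339 / 10, - 203 / 12, 13 / 2, - 9 / 16] / 384"
    by (simp add: m_defs field_simps power2_eq_square power_numeral_reduce)
  have coeffs4: "m1 * m2 - m0\<^sup>2 * m2 - m0 * m1\<^sup>2 + (t ^ 6 / 12 - t ^ 5 / 10)
      = horner_sum (\<lambda>c. c) t [9 / 8, 111 / 16, 175 / 32, - 5 / 8, 575 / 32, - 821 / 15, 257 / 48, 421 / 12, - 1291 / 96, 31 / 16, - 3 / 32] / 384"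
    by (simp add: m_defs field_simps power2_eq_square power_numeral_reduce)
  have coeffs5: "m2\<^sup>2 / 2 - 2 * m0 * m1 * m2 - m1 ^ 3 / 3 + (t ^ 6 / 12 - t ^ 7 / 14)
      = horner_sum (\<lambda>c. c) t [115 / 128, 69 / 64, - 1461 / 128, - 1389 / 64, 8959 / 768, 64 / 3, 799 / 48, - 11299 / 672, - 8317 / 768, 9187 / 1728, - 437 / 384, 7 / 64, - 1 / 256] / 384"
    by (simp add: m_defs field_simps power2_eq_square power_numeral_reduce)
  have coeffs6: "- m0 * m2\<^sup>2 - m1\<^sup>2 * m2 - t ^ 7 / 14
      = horner_sum (\<lambda>c. c) t [759 / 1024, 69 / 16, 3861 / 512, 353 / 128, - 887 / 1536, - 157 / 48, - 5999 / 768, - 16365 / 896, - 29063 / 9216, 325 / 768, - 5 / 256] / 384"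
    by (simp add: m_defs field_simps power2_eq_square power_numeral_reduce)
  have coeffs7: "- m1 * m2\<^sup>2
      = horner_sum (\<lambda>c. c) t [- 363 / 4096, - 693 / 1024, - 4835 / 2048, - 3013 / 1024, 22271 / 12288, 1655 / 512, - 1195 / 512, 575 / 1152, - 25 / 768] / 384"
    by (simp add: m_defs field_simps power2_eq_square power_numeral_reduce)
  have coeffs8: "- (m2 ^ 3) / 3
      = horner_sum (\<lambda>c. c) t [1331 / 16384, 1815 / 4096, 2695 / 4096, - 25 / 512, - 1225 / 3072, 125 / 768, - 125 / 6912] / 384"
    by (simp add: m_defs field_simps power2_eq_square power_numeral_reduce)
  show ?thesis
    unfolding expansion coeffs0 coeffs1 coeffs2 coeffs3 coeffs4 coeffs5 coeffs6 coeffs7 coeffs8 remainder_coeffs_def by (rule collect)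
qed

text \<open>The right-hand side is \<open>f\<^sub>p / \<phi>\<close> with the normalising constant replaced by its lower bound
  \<open>exp (- a / 4)\<close>.\<close>

lemma density_ratio_gt:
  fixes a t :: real
  assumes "0 < a" "a \<le> 1 / 4" "0 \<le> t" "t \<le> 31 / 10"
  shows "1 - a * P_sq a t / 384 < exp (- a / 4 + t / 2 - (1 + a) / (2 * a) * ln (1 + a * t))"
proof -
  define y where "y = - a * P_sq a t / 384"
  define s where "s = a * t"
  show ?thesis
  proof (cases "- 1 < y")
    case True
    have "0 < a ^ 3 / 384 * horner_sum (horner_sum (\<lambda>c. c) t) a remainder_coeffs"
      using assms by (intro mult_pos_pos remainder_pos) auto
    then have "y - y\<^sup>2 / 2 + y ^ 3 / 3
        < - a / 4 + t / 2 - (1 + a) / 2 * (t - a * t\<^sup>2 / 2 + a\<^sup>2 * t ^ 3 / 3 - a ^ 3 * t ^ 4 / 4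
            + a ^ 4 * t ^ 5 / 5 - a ^ 5 * t ^ 6 / 6 + a ^ 6 * t ^ 7 / 7)"
      using remainder_identity[of a t] unfolding y_def by linarith
    also have "\<dots> = - a / 4 + t / 2 - (1 + a) / (2 * a) *
        (s - s\<^sup>2 / 2 + s ^ 3 / 3 - s ^ 4 / 4 + s ^ 5 / 5 - s ^ 6 / 6 + s ^ 7 / 7)"
      using assms by (simp add: s_def power_mult_distrib field_simps power_numeral_reduce)
    also have "\<dots> \<le> - a / 4 + t / 2 - (1 + a) / (2 * a) * ln (1 + s)"
      using assms by (intro diff_left_mono mult_left_mono ln_one_plus_le_degree7) (auto simp: s_def)
    finally have "ln (1 + y) < - a / 4 + t / 2 - (1 + a) / (2 * a) * ln (1 + s)"
      using ln_one_plus_le_cubic[OF True] by linarith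
    then have "exp (ln (1 + y)) < exp (- a / 4 + t / 2 - (1 + a) / (2 * a) * ln (1 + s))"
      by (simp only: exp_less_cancel_iff)
    also have "exp (ln (1 + y)) = 1 - a * P_sq a t / 384"
      using True by (simp add: y_def)
    finally show ?thesis
      by (simp only: s_def)
  next
    case False
    then have "1 - a * P_sq a t / 384 \<le> 0"
      by (simp add: y_def)
    then show ?thesis
      using exp_gt_zero by (rule le_less_trans)
  qed
qed

section \<open>The root of the polynomial\<close>

text \<open>This says that \<open>P / t\<close> decreases, whence \<open>P\<close> has at most one positive zero and passes from plus to
  minus there.  The constant term of \<open>P\<close> is positive and contributes a decreasing part; the other terms
  contribute a cubic in \<open>t\<close>, whose difference quotient is bounded through \<open>\<sigma> = s + t\<close>.\<close>

lemma P_sq_over_t_strict_antimono: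
  assumes "0 < a" "a \<le> 1 / 4" and "0 < s" "s < t"
  shows "s * P_sq a t < t * P_sq a s"
proof -
  define \<sigma> where "\<sigma> = s + t"
  have "0 \<le> a * (12 * (s\<^sup>2 + s * t + t\<^sup>2) - 9 * \<sigma>\<^sup>2)"
    using assms sum_squares_bound[of s t]
    by (intro mult_nonneg_nonneg) (auto simp: \<sigma>_def power2_eq_square algebra_simps)
  \<comment> \<open>\<open>349\<close> exceeds \<open>56\<^sup>2 / 9\<close>, the constant needed to complete the square.\<close>
  moreover have "0 \<le> a * (9 * \<sigma>\<^sup>2 - 112 * \<sigma> + 349)"
  proof -
    have "0 \<le> (3 * \<sigma> - 56 / 3)\<^sup>2"
      by simp
    also have "\<dots> \<le> 9 * \<sigma>\<^sup>2 - 112 * \<sigma> + 349"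
      by (simp add: power2_eq_square algebra_simps)
    finally show ?thesis
      using assms by simp
  qed
  moreover have "0 < 96 - 229 * a + 20 * a\<^sup>2"
    using assms by (intro add_pos_nonneg) auto
  moreover have "12 * a * (s\<^sup>2 + s * t + t\<^sup>2) - 112 * a * \<sigma> + 96 + 120 * a + 20 * a\<^sup>2
      = a * (12 * (s\<^sup>2 + s * t + t\<^sup>2) - 9 * \<sigma>\<^sup>2) + a * (9 * \<sigma>\<^sup>2 - 112 * \<sigma> + 349)
        + (96 - 229 * a + 20 * a\<^sup>2)"
    by (simp add: algebra_simps)
  ultimately have "0 < 12 * a * (s\<^sup>2 + s * t + t\<^sup>2) - 112 * a * \<sigma> + 96 + 120 * a + 20 * a\<^sup>2"
    by linarith
  then have "0 < s * t * (t - s) * (12 * a * (s\<^sup>2 + s * t + t\<^sup>2) - 112 * a * \<sigma> + 96 + 120 * a + 20 * a\<^sup>2)"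
    using assms by (intro mult_pos_pos) auto
  moreover have "0 < (t - s) * (96 - 12 * a + 33 * a\<^sup>2)"
    using assms by (intro mult_pos_pos add_pos_nonneg) auto
  moreover have "t * P_sq a s - s * P_sq a t
      = s * t * (t - s) * (12 * a * (s\<^sup>2 + s * t + t\<^sup>2) - 112 * a * \<sigma> + 96 + 120 * a + 20 * a\<^sup>2)
        + (t - s) * (96 - 12 * a + 33 * a\<^sup>2)"
    by (simp add: P_sq_def \<sigma>_def algebra_simps power_numeral_reduce power2_eq_square)
  ultimately show ?thesis
    by linarith
qed

lemma P_sq_at_2_pos:
  assumes "0 < a" "a \<le> 1 / 4"
  shows "0 < P_sq a 2"
  using assms by (simp add: P_sq_def add_pos_nonneg)

lemma P_sq_at_31_tenths_neg:
  assumes "0 < a" "a \<le> 1 / 4"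
  shows "P_sq a (31 / 10) < 0"
proof -
  have "a * a \<le> a * (1 / 4)"
    using assms by (intro mult_left_mono) auto
  moreover have "P_sq a (31 / 10) = - 5784 / 25 + 2285917 / 2500 * a + 134 / 5 * (a * a)"
    by (simp add: P_sq_def power2_eq_square power_numeral_reduce)
  ultimately show ?thesis
    using assms by linarith
qed

lemma x_tilde_root:
  assumes "0 < a" "a \<le> 1 / 4"
  shows "0 < x_tilde a"
    and "x_tilde a \<le> sqrt (31 / 10)"
    and "P_poly a (x_tilde a) = 0"
    and "\<And>x. 0 < x \<Longrightarrow> x < x_tilde a \<Longrightarrow> 0 < P_poly a x"
    and "\<And>x. x_tilde a < x \<Longrightarrow> P_poly a x < 0"
proof -
  \<comment> \<open>The root lies between \<open>t = 2\<close> and \<open>t = 31 / 10\<close> uniformly in \<open>a\<close>.\<close>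
  have "continuous_on {2..31 / 10} (P_sq a)"
    unfolding P_sq_def by (intro continuous_intros)
  then obtain t where t: "2 \<le> t" "t \<le> 31 / 10" "P_sq a t = 0"
    using IVT2'[of "P_sq a" "31 / 10" 0 2] P_sq_at_2_pos[OF assms] P_sq_at_31_tenths_neg[OF assms] by auto
  have before: "0 < P_poly a x" if "0 < x" "x < sqrt t" for x
  proof -
    have "x\<^sup>2 < t"
      using that t by (metis less_eq_real_def real_sqrt_less_iff real_sqrt_unique)
    then have "0 < t * P_sq a (x\<^sup>2)"
      using P_sq_over_t_strict_antimono[OF assms, of "x\<^sup>2" t] that t by simp
    then show ?thesis
      using t by (simp add: P_poly_eq_P_sq zero_less_mult_iff)
  qed
  have after: "P_poly a x < 0" if "sqrt t < x" for x
  proof -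
    have "t < x\<^sup>2"
      using that t by (metis abs_of_nonneg less_eq_real_def order_less_trans real_sqrt_abs real_sqrt_ge_zero real_sqrt_less_iff zero_le_numeral order_trans)
    then have "t * P_sq a (x\<^sup>2) < 0"
      using P_sq_over_t_strict_antimono[OF assms, of t "x\<^sup>2"] t by simp
    then show ?thesis
      using t by (simp add: P_poly_eq_P_sq mult_less_0_iff)
  qed
  have root: "P_poly a (sqrt t) = 0"
    using t by (simp add: P_poly_eq_P_sq)
  have "x_tilde a = sqrt t"
    unfolding x_tilde_def
  proof (rule the_equality)
    show "0 < sqrt t \<and> P_poly a (sqrt t) = 0"
      using t root by simp
    show "x = sqrt t" if "0 < x \<and> P_poly a x = 0" for x
      using that before[of x] after[of x] by (cases x "sqrt t" rule: linorder_cases) auto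
  qed
  then show "0 < x_tilde a" "x_tilde a \<le> sqrt (31 / 10)" "P_poly a (x_tilde a) = 0"
    "\<And>x. 0 < x \<Longrightarrow> x < x_tilde a \<Longrightarrow> 0 < P_poly a x" "\<And>x. x_tilde a < x \<Longrightarrow> P_poly a x < 0"
    using t root before after by auto
qed

section \<open>The bound on the Kolmogorov distance\<close>

lemma std_normal_density_has_real_derivative [derivative_intros]:
  "(std_normal_density has_real_derivative - x * std_normal_density x) (at x)"
proof -
  have "((\<lambda>x. c * exp (- x\<^sup>2 / 2)) has_real_derivative - x * (c * exp (- x\<^sup>2 / 2))) (at x)" for c
    by (auto intro!: derivative_eq_intros)
  then show ?thesis
    unfolding std_normal_density_def by blast
qed

lemma student_cdf_has_real_derivative:
  assumes "0 < p"
  shows "(student_cdf p has_real_derivative student_density p x) (at x)"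
  using lower_tail_has_real_derivative[of "student_density p" x] student_density_continuous[OF assms]
    student_density_has_integral[OF assms]
  by (simp add: student_cdf_def[abs_def] has_bochner_integral_iff)

lemma student_cdf_0:
  assumes "0 < p"
  shows "student_cdf p 0 = 1 / 2"
proof -
  have "student_density p (- x) = student_density p x" for x
    by (simp add: student_density_eq_exp[OF assms])
  then show ?thesis
    using lower_tail_minus_even[of "student_density p" 0] student_density_has_integral[OF assms]
    by (simp add: student_cdf_def has_bochner_integral_iff)
qed

lemma std_normal_cdf_has_real_derivative:
  "(std_normal_cdf has_real_derivative std_normal_density x) (at x)"
  using student_cdf_has_real_derivative[of "\<infinity>" x]
  by (simp add: student_cdf_infinity student_density_def[abs_def])

lemma B_fun_has_real_derivative:
  "(B_fun a has_real_derivative a / 384 * std_normal_density x * P_poly a x) (at x)"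
  unfolding B_fun_def
  by (auto intro!: derivative_eq_intros std_normal_cdf_has_real_derivative std_normal_density_has_real_derivative)
     (simp add: P_poly_def field_simps power_numeral_reduce power2_eq_square)

text \<open>The derivative of \<open>B a\<close> has the sign of \<open>P\<close>.\<close>

lemma B_fun_le_x_tilde:
  assumes "0 < a" "a \<le> 1 / 4" "0 < x"
  shows "B_fun a x \<le> B_fun a (x_tilde a)"
proof (cases "x \<le> x_tilde a")
  case True
  then show ?thesis
  proof (rule DERIV_nonneg_imp_nondecreasing)
    fix u assume u: "x \<le> u" "u \<le> x_tilde a"
    then have "0 \<le> P_poly a u"
      using x_tilde_root(3)[OF assms(1,2)] x_tilde_root(4)[OF assms(1,2), of u] assms
      by (cases "u = x_tilde a") auto
    then show "\<exists>y. (B_fun a has_real_derivative y) (at u) \<and> 0 \<le> y"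
      using assms
      by (intro exI[of _ "a / 384 * std_normal_density u * P_poly a u"] conjI B_fun_has_real_derivative) simp
  qed
next
  case False
  then have "x_tilde a \<le> x"
    by simp
  then show ?thesis
  proof (rule DERIV_nonpos_imp_nonincreasing)
    fix u assume u: "x_tilde a \<le> u" "u \<le> x"
    then have "P_poly a u \<le> 0"
      using x_tilde_root(3)[OF assms(1,2)] x_tilde_root(5)[OF assms(1,2), of u]
      by (cases "u = x_tilde a") auto
    then show "\<exists>y. (B_fun a has_real_derivative y) (at u) \<and> y \<le> 0"
      using assms
      by (intro exI[of _ "a / 384 * std_normal_density u * P_poly a u"] conjI B_fun_has_real_derivative
          mult_nonneg_nonpos) simp_all
  qed
qed

lemma student_density_gt:
  assumes "4 \<le> p" and "x\<^sup>2 \<le> 31 / 10"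
  shows "std_normal_density x * (1 - 1 / p * P_poly (1 / p) x / 384) < student_density (ereal p) x"
proof -
  define a where "a = 1 / p"
  have a: "0 < a" "a \<le> 1 / 4" and p: "0 < p"
    using assms by (auto simp: a_def field_simps)
  have "- 1 / (8 * (p / 2)) \<le> ln_gamma_half_step (p / 2)"
    using p by (intro ln_gamma_half_step_lower) simp
  then have "- a / 4 \<le> ln_gamma_half_step (p / 2)"
    by (simp add: a_def)
  moreover have "(p + 1) / 2 * ln (1 + x\<^sup>2 / p) = (1 + a) / (2 * a) * ln (1 + a * x\<^sup>2)"
    using p by (simp add: a_def field_simps)
  ultimately have "- a / 4 + x\<^sup>2 / 2 - (1 + a) / (2 * a) * ln (1 + a * x\<^sup>2)
      \<le> student_log_density (ereal p) (x\<^sup>2) - student_log_density \<infinity> (x\<^sup>2)"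
    by (simp add: student_log_density_def)
  then have "1 - a * P_sq a (x\<^sup>2) / 384
      < exp (student_log_density (ereal p) (x\<^sup>2) - student_log_density \<infinity> (x\<^sup>2))"
    using density_ratio_gt[of a "x\<^sup>2"] a assms(2) by (meson exp_le_cancel_iff less_le_trans zero_le_power2)
  also have "\<dots> = student_density (ereal p) x / std_normal_density x"
    using student_density_eq_exp[of "ereal p" x] student_density_eq_exp[of \<infinity> x] p
    by (simp add: exp_diff student_density_def[of \<infinity>])
  finally show ?thesis
    by (simp add: P_poly_eq_P_sq a_def pos_less_divide_eq normal_density_pos mult.commute)
qed

lemma cdf_gap_less_B_fun:
  assumes "4 \<le> p" and "0 < x" "x \<le> sqrt (31 / 10)"
  shows "std_normal_cdf x - student_cdf (ereal p) x < B_fun (1 / p) x"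
proof -
  define D where "D x = B_fun (1 / p) x - (std_normal_cdf x - student_cdf (ereal p) x)" for x
  have p: "0 < p"
    using assms by simp
  have "D 0 < D x"
  proof (rule DERIV_pos_imp_increasing[OF assms(2)])
    fix u assume u: "0 \<le> u" "u \<le> x"
    then have "u\<^sup>2 \<le> 31 / 10"
      using assms by (metis order_trans real_sqrt_abs real_sqrt_le_iff abs_of_nonneg)
    then have "0 < 1 / p / 384 * std_normal_density u * P_poly (1 / p) u
        - (std_normal_density u - student_density (ereal p) u)"
      using student_density_gt[OF assms(1), of u] by (simp add: algebra_simps)
    moreover have "(D has_real_derivative 1 / p / 384 * std_normal_density u * P_poly (1 / p) u
        - (std_normal_density u - student_density (ereal p) u)) (at u)"
      unfolding D_def using p
      by (intro DERIV_diff B_fun_has_real_derivative std_normal_cdf_has_real_derivative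
          student_cdf_has_real_derivative) simp
    ultimately show "\<exists>y. (D has_real_derivative y) (at u) \<and> 0 < y"
      by blast
  qed
  moreover have half: "std_normal_cdf 0 = 1 / 2" "student_cdf (ereal p) 0 = 1 / 2"
    using student_cdf_0[of "\<infinity>"] student_cdf_0[of "ereal p"] p
    by (simp_all add: student_cdf_infinity)
  have "D 0 = 0"
    unfolding D_def B_fun_def half by simp
  ultimately show ?thesis
    by (simp add: D_def)
qed

text \<open>Up to \<open>T = sqrt (31 / 10)\<close> the pointwise bound applies.  At \<open>T\<close> the polynomial is negative, so
  the densities have already crossed and the gap can only decrease further out.\<close>

lemma cdf_gap_less_B_fun_x_tilde:
  assumes "4 \<le> p" and "0 < x"
  shows "std_normal_cdf x - student_cdf (ereal p) x < B_fun (1 / p) (x_tilde (1 / p))"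
proof -
  define T :: real where "T = sqrt (31 / 10)"
  have a: "0 < 1 / p" "1 / p \<le> 1 / 4" and p: "0 < ereal p" and "0 < T"
    using assms by (auto simp: field_simps T_def)
  have near: "std_normal_cdf y - student_cdf (ereal p) y < B_fun (1 / p) (x_tilde (1 / p))"
    if "0 < y" "y \<le> T" for y
    using cdf_gap_less_B_fun[OF assms(1), of y] B_fun_le_x_tilde[OF a, of y] that
    by (simp add: T_def)
  show ?thesis
  proof (cases "x \<le> T")
    case True
    then show ?thesis
      using near assms by blast
  next
    case False
    interpret symmetric_pair "student_density (ereal p)" "student_density \<infinity>"
      using p by (intro symmetric_pair_student) auto
    have gap: "gap y = std_normal_cdf y - student_cdf (ereal p) y" for y
      by (simp add: gap_def student_cdf_def student_cdf_infinity[symmetric])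
    obtain c where c: "0 < c"
      "\<And>x. 0 \<le> x \<Longrightarrow> x \<le> c \<Longrightarrow> student_density (ereal p) x \<le> student_density \<infinity> x"
      "\<And>x. c \<le> x \<Longrightarrow> student_density \<infinity> x \<le> student_density (ereal p) x"
      using student_densities_cross_once[OF p, of "\<infinity>"] by auto
    have "P_poly (1 / p) T \<le> 0"
      using P_sq_at_31_tenths_neg[OF a] by (simp add: P_poly_eq_P_sq T_def)
    then have "0 \<le> std_normal_density T * - (1 / p * P_poly (1 / p) T / 384)"
      using a by (intro mult_nonneg_nonneg) (auto simp: mult_le_0_iff zero_le_divide_iff divide_le_0_iff)
    then have "student_density \<infinity> T < student_density (ereal p) T"
      using student_density_gt[OF assms(1), of T]
      by (simp add: student_density_def[of \<infinity>] T_def algebra_simps)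
    then have "c \<le> T"
      using c(2)[of T] \<open>0 < T\<close> by (cases "T \<le> c") auto
    then have "gap x \<le> gap T"
      using False c(3) by (intro gap_antimono) auto
    then show ?thesis
      using near[of T] \<open>0 < T\<close> by (simp add: gap)
  qed
qed

section \<open>Comparison with the limit constant\<close>

text \<open>Mills' ratio bound \<open>1 - \<Phi> x \<ge> x / (1 + x\<^sup>2) * \<phi> x\<close>: the difference of the two sides decreases to
  \<open>0\<close>.\<close>

lemma std_normal_cdf_upper:
  assumes "0 \<le> x"
  shows "2 * std_normal_cdf x - 1 \<le> 1 - 2 * x / (1 + x\<^sup>2) * std_normal_density x"
proof -
  define M where "M x = 1 - std_normal_cdf x - x / (1 + x\<^sup>2) * std_normal_density x" for x
  have pos: "0 < 1 + u\<^sup>2" for u :: real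
    by (simp add: add_pos_nonneg)
  have deriv: "(M has_real_derivative - 2 / (1 + u\<^sup>2)\<^sup>2 * std_normal_density u) (at u)" for u
    unfolding M_def using pos[of u]
    by (auto intro!: derivative_eq_intros std_normal_cdf_has_real_derivative std_normal_density_has_real_derivative)
       (simp add: divide_simps, simp add: algebra_simps power2_eq_square)
  have anti: "M y \<le> M x" if "x \<le> y" for y
    using that
  proof (rule DERIV_nonpos_imp_nonincreasing)
    fix u
    show "\<exists>z. (M has_real_derivative z) (at u) \<and> z \<le> 0"
      by (intro exI[of _ "- 2 / (1 + u\<^sup>2)\<^sup>2 * std_normal_density u"] conjI deriv) simp
  qed
  have "(M \<longlongrightarrow> 1 - 1 - 0) at_top"
    unfolding M_def
  proof (intro tendsto_diff tendsto_const)
    interpret real_distribution std_normal_distribution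
      by (rule real_dist_normal_dist)
    show "(std_normal_cdf \<longlongrightarrow> 1) at_top"
      unfolding std_normal_cdf_def by (rule cdf_lim_at_top_prob)
    show "((\<lambda>x. x / (1 + x\<^sup>2) * std_normal_density x) \<longlongrightarrow> 0) at_top"
      unfolding std_normal_density_def by real_asymp
  qed
  moreover have "\<forall>\<^sub>F y in at_top. M y \<le> M x"
    using eventually_ge_at_top[of x] by eventually_elim (rule anti)
  ultimately have "0 \<le> M x"
    using tendsto_upperbound[of M 0 at_top "M x"] by simp
  then show ?thesis
    by (simp add: M_def)
qed

text \<open>The left-hand side is the limit of \<open>B a x / a\<close> as \<open>a\<close> tends to \<open>0\<close>.  Its derivative vanishes
  only at \<open>x\<^sup>2 = 1 + sqrt 2\<close>, where its value is \<open>C\<close>.\<close>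

lemma leading_term_le_C_const:
  assumes "0 \<le> x"
  shows "x * (x\<^sup>2 + 1) * std_normal_density x / 4 \<le> C_const"
proof -
  define g where "g x = x * (x\<^sup>2 + 1) * std_normal_density x / 4" for x
  define r where "r = sqrt (1 + sqrt 2)"
  have sqrt2: "0 \<le> sqrt 2" "sqrt 2 * sqrt 2 = 2" and r: "0 < r" "r\<^sup>2 = 1 + sqrt 2"
    by (simp_all add: r_def add_pos_nonneg)
  have factorisation: "(1 + sqrt 2 - v) * (v + (sqrt 2 - 1)) = 2 - (v - 1)\<^sup>2" for v :: real
    by (simp add: algebra_simps power2_eq_square)
  have deriv: "(g has_real_derivative (1 + sqrt 2 - u\<^sup>2) * ((u\<^sup>2 + (sqrt 2 - 1)) * std_normal_density u / 4)) (at u)"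
    for u
  proof -
    have "(g has_real_derivative (2 - (u\<^sup>2 - 1)\<^sup>2) * std_normal_density u / 4) (at u)"
      unfolding g_def
      by (auto intro!: derivative_eq_intros std_normal_density_has_real_derivative)
         (simp add: algebra_simps power2_eq_square)
    then show ?thesis
      by (simp add: factorisation[symmetric] mult.assoc)
  qed
  have factor: "0 \<le> (u\<^sup>2 + (sqrt 2 - 1)) * std_normal_density u / 4" for u
    by (intro divide_nonneg_pos mult_nonneg_nonneg add_nonneg_nonneg) auto
  have "g x \<le> g r"
  proof (cases "x \<le> r")
    case True
    then show ?thesis
    proof (rule DERIV_nonneg_imp_nondecreasing)
      fix u assume "x \<le> u" "u \<le> r"
      then have "u\<^sup>2 \<le> r\<^sup>2"
        using assms by (intro power_mono) auto
      then have "0 \<le> (1 + sqrt 2 - u\<^sup>2) * ((u\<^sup>2 + (sqrt 2 - 1)) * std_normal_density u / 4)"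
        using r by (intro mult_nonneg_nonneg factor) simp
      then show "\<exists>y. (g has_real_derivative y) (at u) \<and> 0 \<le> y"
        using deriv by blast
    qed
  next
    case False
    then have "r \<le> x"
      by simp
    then show ?thesis
    proof (rule DERIV_nonpos_imp_nonincreasing)
      fix u assume "r \<le> u" "u \<le> x"
      then have "r\<^sup>2 \<le> u\<^sup>2"
        using r by (intro power_mono) auto
      then have "(1 + sqrt 2 - u\<^sup>2) * ((u\<^sup>2 + (sqrt 2 - 1)) * std_normal_density u / 4) \<le> 0"
        using r by (intro mult_nonpos_nonneg factor) simp
      then show "\<exists>y. (g has_real_derivative y) (at u) \<and> y \<le> 0"
        using deriv by blast
    qed
  qed
  also have "g r = C_const"
  proof -
    define e where "e = exp (- (1 + sqrt 2) / 2)"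
    have e: "0 < e" "e\<^sup>2 = exp (- (1 + sqrt 2))"
      by (simp_all add: e_def power2_eq_square exp_add[symmetric])
    have "(r * (2 + sqrt 2) / sqrt (2 * pi) * e)\<^sup>2
        = (1 + sqrt 2) * (2 + sqrt 2)\<^sup>2 / (2 * pi) * exp (- (1 + sqrt 2))"
      by (simp add: power_mult_distrib power_divide r e)
    also have "(1 + sqrt 2) * (2 + sqrt 2)\<^sup>2 = 2 * (7 + 5 * sqrt 2)"
      by (simp add: algebra_simps power2_eq_square)
    also have "2 * (7 + 5 * sqrt 2) / (2 * pi) * exp (- (1 + sqrt 2)) = (7 + 5 * sqrt 2) / (pi * exp (1 + sqrt 2))"
      unfolding exp_minus by (simp only: inverse_eq_divide times_divide_times_eq)
    finally have square: "(r * (2 + sqrt 2) / sqrt (2 * pi) * e)\<^sup>2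
        = (7 + 5 * sqrt 2) / (pi * exp (1 + sqrt 2))" .
    have "0 \<le> r * (2 + sqrt 2) / sqrt (2 * pi) * e"
      using r e by (intro mult_nonneg_nonneg divide_nonneg_nonneg) auto
    then have "C_const = 1 / 4 * (r * (2 + sqrt 2) / sqrt (2 * pi) * e)"
      unfolding C_const_def by (simp only: real_sqrt_unique[OF square])
    moreover have "r * (r\<^sup>2 + 1) * (1 / sqrt (2 * pi) * exp (- r\<^sup>2 / 2)) / 4
        = 1 / 4 * (r * (2 + sqrt 2) / sqrt (2 * pi) * e)"
      unfolding r(2) e_def by (simp add: field_simps)
    ultimately show ?thesis
      by (simp only: g_def std_normal_density_def)
  qed
  finally show ?thesis
    by (simp add: g_def)
qed

text \<open>From \<open>sin (pi / 6) = 1 / 2 < sin (21 / 40)\<close>, the latter by \<open>sin x \<ge> x - x ^ 3 / 6\<close>.\<close>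

lemma pi_less_315: "pi < 315 / 100"
proof (rule ccontr)
  assume "\<not> ?thesis"
  then have "21 / 40 \<le> pi / 6"
    by simp
  then have "sin (21 / 40) \<le> sin (pi / 6)"
    by (intro sin_monotone_2pi_le) auto
  moreover have "1 / 2 < sin (21 / 40 :: real)"
  proof -
    define D where "D x = sin x - (x - x ^ 3 / 6)" for x :: real
    have "D 0 \<le> D (21 / 40)"
    proof (rule DERIV_nonneg_imp_nondecreasing[of 0 "21 / 40" D])
      fix u :: real
      have "(D has_real_derivative cos u - (1 - u\<^sup>2 / 2)) (at u)"
        unfolding D_def by (auto intro!: derivative_eq_intros)
      moreover have "0 \<le> cos u - (1 - u\<^sup>2 / 2)"
      proof -
        have "(sin (u / 2))\<^sup>2 \<le> (u / 2)\<^sup>2"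
          using abs_sin_x_le_abs_x[of "u / 2"] by (simp only: abs_le_square_iff)
        then show ?thesis
          using cos_double_sin[of "u / 2"] by (simp add: power_divide)
      qed
      ultimately show "\<exists>y. (D has_real_derivative y) (at u) \<and> 0 \<le> y"
        by blast
    qed simp
    then show ?thesis
      by (simp add: D_def power3_eq_cube)
  qed
  ultimately show False
    by (simp add: sin_30)
qed

text \<open>An upper bound for \<open>ln (1 / v)\<close> is a lower bound for \<open>ln v\<close>.\<close>

lemma exp_le_of_ln_cubic:
  fixes w v :: real
  assumes "1 / 2 < v" and "w \<le> - ((1 / v - 1) - (1 / v - 1)\<^sup>2 / 2 + (1 / v - 1) ^ 3 / 3)"
  shows "exp w \<le> v"
proof -
  have "ln (1 + (1 / v - 1)) \<le> (1 / v - 1) - (1 / v - 1)\<^sup>2 / 2 + (1 / v - 1) ^ 3 / 3"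
    using assms by (intro ln_one_plus_le_cubic) (simp add: field_simps)
  then have "w \<le> ln v"
    using assms by (simp add: ln_div)
  then show ?thesis
    using assms by (simp add: ln_ge_iff)
qed

lemma sqrt_2_bounds: "1414213 / 1000000 \<le> sqrt 2" "sqrt 2 \<le> 1414214 / 1000000"
  by (rule real_le_rsqrt, simp add: power2_eq_square, rule real_le_lsqrt, simp_all add: power2_eq_square)

text \<open>The cubic logarithm bound is sharp enough only near \<open>1\<close>, hence the eighth root.\<close>

lemma exp_half_one_plus_sqrt_2: "exp ((1 + sqrt 2) / 2) \<le> (11631 / 10000) ^ 8"
proof -
  have "exp ((1 + sqrt 2) / 16) \<le> 11631 / 10000"
    using sqrt_2_bounds by (intro exp_le_of_ln_cubic) (auto simp: power2_eq_square power3_eq_cube)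
  then have "exp ((1 + sqrt 2) / 16) ^ 8 \<le> (11631 / 10000) ^ 8"
    by (intro power_mono) auto
  also have "exp ((1 + sqrt 2) / 16) ^ 8 = exp (real 8 * ((1 + sqrt 2) / 16))"
    by (rule exp_of_nat_mult[symmetric])
  finally show ?thesis
    by (simp add: add_divide_distrib)
qed

text \<open>With \<open>t\<close> near \<open>3.093\<close> this is \<open>\<phi> x / \<phi> (sqrt (1 + sqrt 2))\<close>.  The comparison with \<open>C\<close> tolerates a relative
  error of about \<open>0.0001\<close>; taking the square root first makes the logarithm bound precise enough.\<close>

lemma exp_neg_half_excess_le:
  assumes "309295 / 100000 \<le> t"
  shows "exp (- (t - (1 + sqrt 2)) / 2) \<le> (100000 / 118492)\<^sup>2"
proof -
  have "ln (1 + 18492 / 100000) \<le> (t - (1 + sqrt 2)) / 4"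
    using sqrt_2_bounds assms ln_one_plus_le_degree7[of "18492 / 100000"] by (simp add: power_numeral_reduce)
  then have "exp (ln (1 + 18492 / 100000)) \<le> exp ((t - (1 + sqrt 2)) / 4)"
    by (simp only: exp_le_cancel_iff)
  then have "inverse (exp ((t - (1 + sqrt 2)) / 4)) \<le> 100000 / 118492"
    by (simp add: field_simps)
  then have "exp (- (t - (1 + sqrt 2)) / 4) \<le> 100000 / 118492"
    by (simp add: exp_minus[symmetric] minus_divide_left)
  then have "exp (- (t - (1 + sqrt 2)) / 4) ^ 2 \<le> (100000 / 118492)\<^sup>2"
    by (intro power_mono) auto
  then show ?thesis
    by (simp add: exp_of_nat_mult[symmetric] power2_eq_square exp_add[symmetric])
qed

lemma x_tilde_quarter: "309295 / 100000 \<le> (x_tilde (1 / 4))\<^sup>2" "(x_tilde (1 / 4))\<^sup>2 \<le> 309296 / 100000"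
proof -
  have a: "0 < (1 / 4 :: real)" "1 / 4 \<le> (1 / 4 :: real)"
    by simp_all
  note root = x_tilde_root[OF a]
  have "P_poly (1 / 4) (sqrt (309295 / 100000)) > 0" "P_poly (1 / 4) (sqrt (309296 / 100000)) < 0"
    by (simp_all add: P_poly_eq_P_sq P_sq_def power2_eq_square power_numeral_reduce)
  then have "sqrt (309295 / 100000) \<le> x_tilde (1 / 4)" "x_tilde (1 / 4) \<le> sqrt (309296 / 100000)"
    using root(4)[of "sqrt (309296 / 100000)"] root(5)[of "sqrt (309295 / 100000)"] by (auto simp: not_less[symmetric])
  then show "309295 / 100000 \<le> (x_tilde (1 / 4))\<^sup>2" "(x_tilde (1 / 4))\<^sup>2 \<le> 309296 / 100000"
    using power_mono[of "sqrt (309295 / 100000)" "x_tilde (1 / 4)" 2]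
      power_mono[of "x_tilde (1 / 4)" "sqrt (309296 / 100000)" 2] root(1)
    by simp_all
qed

text \<open>By maximality of \<open>x_tilde (1 / 4)\<close> a single evaluation suffices.  Multiplying by
  \<open>sqrt (2 * pi) * exp ((1 + sqrt 2) / 2)\<close> turns \<open>C\<close> into \<open>sqrt (14 + 10 * sqrt 2) / 4\<close> and leaves one exponential
  factor that has to be known accurately.  The margin is below \<open>0.0003\<close> of \<open>C\<close>, so bounding
  \<open>2 * \<Phi> x - 1\<close> by \<open>1\<close> would be too crude and Mills' ratio is used.\<close>

lemma B_fun_quarter_less:
  assumes "0 < x"
  shows "4 * B_fun (1 / 4) x < C_const"
proof -
  define z where "z = x_tilde (1 / 4)"
  define t where "t = z\<^sup>2"
  define w where "w = exp ((1 + sqrt 2) / 2)"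
  define Y where "Y = 5 / 16 * t + (3 * t ^ 3 - 7 * t\<^sup>2 - 5 * t - 3) / 4 + 24 * (t + 1)"
  define m where "m = 33 / (8 * (1 + t))"
  have z: "0 < z"
    using x_tilde_root(1)[of "1 / 4"] by (simp add: z_def)
  have t: "309295 / 100000 \<le> t" "t \<le> 309296 / 100000"
    using x_tilde_quarter by (simp_all add: t_def z_def)
  have z_le: "z \<le> 1758682 / 1000000"
  proof (rule power2_le_imp_le)
    have "t \<le> (1758682 / 1000000)\<^sup>2"
      using t(2) by (rule order_trans) (simp add: power2_eq_square)
    then show "z\<^sup>2 \<le> (1758682 / 1000000)\<^sup>2"
      by (simp only: t_def)
  qed simp
  have "(309295 / 100000)\<^sup>2 \<le> t\<^sup>2" "t ^ 3 \<le> (309296 / 100000) ^ 3"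
    using t by (intro power_mono; linarith)+
  moreover have "33 / (8 * (1 + 309296 / 100000)) \<le> m"
    unfolding m_def using t by (intro divide_left_mono) auto
  moreover have "8 * (5 / 16 * (309296 / 100000 :: real) + (3 * (309296 / 100000) ^ 3 - 7 * (309295 / 100000)\<^sup>2
        - 5 * (309296 / 100000) - 3) / 4 + 24 * (309296 / 100000 + 1)) - 33 / (8 * (1 + 309296 / 100000))
      \<le> 79924563 / 100000"
    by (simp add: power_numeral_reduce power2_eq_square)
  moreover have "8 * (5 / 16 * t + (3 * t3 - 7 * t2 - 5 * t - 3) / 4 + 24 * (t + 1)) - m \<le> B"
    if "l2 \<le> t2" "t3 \<le> u3" "k \<le> m"
      "8 * (5 / 16 * u + (3 * u3 - 7 * l2 - 5 * u - 3) / 4 + 24 * (u + 1)) - k \<le> B" "t \<le> u"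
    for t2 t3 l2 u3 k u B :: real
    using that by (simp add: field_simps)
  ultimately have K_le: "8 * Y - m \<le> 79924563 / 100000"
    using t(2) unfolding Y_def by blast
  have pi_le: "sqrt (2 * pi) \<le> 251 / 100"
    using pi_less_315 by (intro real_le_lsqrt) (auto simp: power2_eq_square)
  have density: "std_normal_density z * sqrt (2 * pi) * w = exp (- (t - (1 + sqrt 2)) / 2)"
  proof -
    have "- (t - (1 + sqrt 2)) / 2 = - z\<^sup>2 / 2 + (1 + sqrt 2) / 2"
      by (simp add: t_def field_simps)
    then show ?thesis
      by (simp only: exp_add std_normal_density_def w_def) simp
  qed
  have "768 * (4 * B_fun (1 / 4) z) = 8 * z * Y * std_normal_density z + 33 / 16 * (2 * std_normal_cdf z - 1)"
    by (simp add: B_fun_def Y_def t_def power_mult[symmetric] power2_eq_square power_numeral_reduce field_simps)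
  also have "\<dots> \<le> 8 * z * Y * std_normal_density z + 33 / 16 * (1 - 2 * z / (1 + t) * std_normal_density z)"
    using std_normal_cdf_upper[of z] z by (intro add_left_mono mult_left_mono) (auto simp: t_def)
  also have "33 / 16 * (1 - 2 * z / (1 + t) * std_normal_density z) = 33 / 16 - z * m * std_normal_density z"
    using t by (simp add: m_def divide_simps) (simp add: algebra_simps)
  finally have "768 * (4 * B_fun (1 / 4) z) \<le> z * (8 * Y - m) * std_normal_density z + 33 / 16"
    by (simp add: algebra_simps)
  then have "768 * (4 * B_fun (1 / 4) z) * (sqrt (2 * pi) * w)
      \<le> (z * (8 * Y - m) * std_normal_density z + 33 / 16) * (sqrt (2 * pi) * w)"
    by (intro mult_right_mono) (simp_all add: w_def)
  also have "\<dots> = z * (8 * Y - m) * (std_normal_density z * sqrt (2 * pi) * w) + 33 / 16 * (sqrt (2 * pi) * w)"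
    by (simp add: algebra_simps)
  also have "\<dots> \<le> 1758682 / 1000000 * (79924563 / 100000) * (100000 / 118492)\<^sup>2
      + 33 / 16 * (251 / 100 * (11631 / 10000) ^ 8)"
    unfolding density
  proof (intro add_mono mult_left_mono)
    show "z * (8 * Y - m) * exp (- (t - (1 + sqrt 2)) / 2)
        \<le> 1758682 / 1000000 * (79924563 / 100000) * (100000 / 118492)\<^sup>2"
    proof (rule mult_mono)
      have "z * (8 * Y - m) \<le> z * (79924563 / 100000)"
        using z K_le by (intro mult_left_mono) auto
      also have "\<dots> \<le> 1758682 / 1000000 * (79924563 / 100000)"
        using z_le by (intro mult_right_mono) auto
      finally show "z * (8 * Y - m) \<le> 1758682 / 1000000 * (79924563 / 100000)" .
    qed (use exp_neg_half_excess_le[OF t(1)] in auto)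
    show "sqrt (2 * pi) * w \<le> 251 / 100 * (11631 / 10000) ^ 8"
      using pi_le exp_half_one_plus_sqrt_2 by (intro mult_mono) (auto simp: w_def)
  qed simp
  also have "\<dots> < 768 * (53049 / 40000)"
    by (simp add: power_numeral_reduce power2_eq_square)
  also have "\<dots> \<le> 768 * (C_const * (sqrt (2 * pi) * w))"
  proof -
    have "w\<^sup>2 = exp (1 + sqrt 2)"
      by (simp add: w_def power2_eq_square exp_add[symmetric])
    then have "w = sqrt (exp (1 + sqrt 2))"
      by (intro real_sqrt_unique[symmetric]) (simp_all add: w_def)
    then have "C_const * (sqrt (2 * pi) * w)
        = 1 / 4 * sqrt ((7 + 5 * sqrt 2) / (pi * exp (1 + sqrt 2)) * (2 * pi * exp (1 + sqrt 2)))"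
      by (simp only: C_const_def real_sqrt_mult mult.assoc)
    also have "\<dots> = 1 / 4 * sqrt (14 + 10 * sqrt 2)"
      by (simp add: field_simps)
    finally have "C_const * (sqrt (2 * pi) * w) = 1 / 4 * sqrt (14 + 10 * sqrt 2)" .
    moreover have "53049 / 10000 \<le> sqrt (14 + 10 * sqrt 2)"
      using sqrt_2_bounds by (intro real_le_rsqrt) (simp add: power2_eq_square)
    ultimately show ?thesis
      by linarith
  qed
  finally have "4 * B_fun (1 / 4) z * (sqrt (2 * pi) * w) < C_const * (sqrt (2 * pi) * w)"
    by (simp only: mult.assoc)
  moreover have "0 < sqrt (2 * pi) * w"
    by (simp add: w_def)
  ultimately have "4 * B_fun (1 / 4) z < C_const"
    by (simp only: mult_less_cancel_right_pos)
  then show ?thesis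
    using B_fun_le_x_tilde[of "1 / 4" x] assms by (simp add: z_def)
qed

text \<open>Convexity in \<open>a\<close> of \<open>B a x / a = d0 + a * d1 + a\<^sup>2 * d2\<close> reduces the claim to \<open>a = 0\<close>, where
  equality with \<open>C\<close> is possible, and \<open>a = 1 / 4\<close>, where it is not.\<close>

lemma B_fun_less_C_const:
  assumes "0 < a" "a \<le> 1 / 4" "0 < x"
  shows "B_fun a x < a * C_const"
proof -
  define d0 d1 d2 where "d0 = x * (x\<^sup>2 + 1) * std_normal_density x / 4"
    and "d1 = x * (3 * x ^ 6 - 7 * x ^ 4 - 5 * x\<^sup>2 - 3) * std_normal_density x / 96"
    and "d2 = (40 * x ^ 3 * std_normal_density x + 33 * (2 * std_normal_cdf x - 1)) / 768"
  have expand: "B_fun b x = b * (d0 + b * d1 + b\<^sup>2 * d2)" for b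
    by (simp add: B_fun_def d0_def d1_def d2_def field_simps power2_eq_square power_numeral_reduce)
  have "1 / 2 \<le> std_normal_cdf x"
  proof -
    have "std_normal_cdf 0 \<le> std_normal_cdf x"
    proof (rule DERIV_nonneg_imp_nondecreasing[of 0 x])
      fix u :: real
      show "\<exists>y. (std_normal_cdf has_real_derivative y) (at u) \<and> 0 \<le> y"
        using std_normal_cdf_has_real_derivative[of u] normal_density_nonneg[of 0 1 u] by blast
    qed (use assms in simp)
    then show ?thesis
      using student_cdf_0[of "\<infinity>"] by (simp add: student_cdf_infinity)
  qed
  then have "0 \<le> d2"
    using assms by (simp add: d2_def)
  then have "a * a * d2 \<le> a * (1 / 4) * d2"
    using assms by (intro mult_mono) auto
  then have "d0 + a * d1 + a\<^sup>2 * d2 \<le> (1 - 4 * a) * d0 + 4 * a * (d0 + 1 / 4 * d1 + (1 / 4)\<^sup>2 * d2)"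
    by (simp add: power2_eq_square algebra_simps)
  also have "\<dots> < (1 - 4 * a) * C_const + 4 * a * C_const"
  proof (rule add_le_less_mono)
    show "(1 - 4 * a) * d0 \<le> (1 - 4 * a) * C_const"
      using assms leading_term_le_C_const[of x] by (intro mult_left_mono) (auto simp: d0_def)
    show "4 * a * (d0 + 1 / 4 * d1 + (1 / 4)\<^sup>2 * d2) < 4 * a * C_const"
      using assms B_fun_quarter_less[of x] by (intro mult_strict_left_mono) (auto simp: expand)
  qed
  also have "\<dots> = C_const"
    by (simp add: algebra_simps)
  finally show ?thesis
    using assms by (simp add: expand)
qed

section \<open>Exact bounds on the distances\<close>

theorem corollary1p4:
  fixes p :: real and q :: ereal and a :: real
  assumes "4 \<le> p" and "ereal p < q" and "a = 1 / p"
  shows "1 / 2 * d_TV (ereal p) q = d_Ko (ereal p) q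
       \<and> d_Ko (ereal p) q < B_fun a (x_tilde a)
       \<and> B_fun a (x_tilde a) < C_const / p"
proof (intro conjI)
  have p: "0 < ereal p"
    using assms(1) by simp
  have a: "0 < a" "a \<le> 1 / 4"
    using assms(1) unfolding assms(3) by (simp_all add: field_simps)
  show "1 / 2 * d_TV (ereal p) q = d_Ko (ereal p) q"
    using p assms(2) by (rule half_d_TV_eq_d_Ko)
  obtain c where c: "0 < c" "d_Ko (ereal p) q = student_cdf q c - student_cdf (ereal p) c"
    using d_Ko_attained[OF p assms(2)] by blast
  have "student_cdf q c \<le> std_normal_cdf c"
    using student_cdf_mono[of q "\<infinity>" c] c(1) less_trans[OF p assms(2)] by (simp add: student_cdf_infinity)
  then show "d_Ko (ereal p) q < B_fun a (x_tilde a)"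
    using cdf_gap_less_B_fun_x_tilde[OF assms(1) c(1)] c(2) assms(3) by simp
  show "B_fun a (x_tilde a) < C_const / p"
    using B_fun_less_C_const[OF a x_tilde_root(1)[OF a]] assms(3) by simp
qed

end
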